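(* Let $q\in[1,\infty]$, let $(k_N)_{N\in\mathbb N}$ be a sequence of positive integers and $(G_N)_{N\in\mathbb N}$ a sequence of finite Abelian groups. For each $N$, let $Z_{(N)}=[Z_1,\dots,Z_{k_N}]$ with $Z_1,\dots,Z_{k_N}$ i.i.d. uniform on $G_N$. Suppose that (with $k^{1/\infty}:=1$): (a) $k_N\to\infty$ and $k_N/\log|G_N|\to0$; (b) $k_N^{1/q}|G_N|^{1/k_N}/m_*(G_N)\to0$; (c) if $q\in(1,\infty)$, then $k_N\le\log|G_N|/\log\log|G_N|$ for all $N$; (d) $\limsup_{N\to\infty}d(G_N)/k_N<1$ in the case of undirected graphs, and $\limsup_{N\to\infty}d(G_N)/k_N<\frac12$ in the case of directed graphs. Then for all $\beta\in(0,1)$, $$\mathcal D^\pm_{N,q}(\beta)\,/\,\mathfrak D^\pm_{N,q}\to1\quad\text{in probability as }N\to\infty,$$ where $\mathcal D^\pm_{N,q}(\beta)$ is the $L_q$ $\beta$-typical distance in the directed ($+$), respectively undirected ($-$), Cayley graph of $G_N$ generated by $Z_{(N)}$. Moreover, the implicit lower bound holds for all choices of generators and for all Abelian groups, requiring only the conditions depending only on $(k_N,|G_N|)_N$ and $q$: under (a) and (c) alone, for all $\beta\in(0,1)$ and $\varepsilon>0$, for all sufficiently large $N$ and every choice of $k_N$ elements of $G_N$ as generators, the corresponding typical distance is at least $(1-\varepsilon)\mathfrak D^\pm_{N,q}$.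
   Context: $d(G)$ is the minimal number of cyclic factors in a decomposition $G=\oplus_{j=1}^{d}\mathbb Z_{m_j}$ (the minimal size of a generating set of $G$), and $m_*(G):=\max\{\min_{j}m_j : \oplus_{j=1}^{r}\mathbb Z_{m_j}\text{ is a decomposition of }G\}$. $L_q$ graph distance and typical distance: let $z=[z_1,\dots,z_k]$ be a multiset of elements of $G$. For a path $\rho$ in the Cayley graph $G(z)$ starting at the identity, let $\rho_{i,+}$ be the number of times $z_i$ is used and $\rho_{i,-}$ the number of times $z_i^{-1}$ is used (in the directed case inverses cannot be used, so $\rho_{i,-}:=0$). The $L_q$ length of $\rho$ is $\|\rho\|_q:=\bigl(\sum_{i=1}^k(\rho_{i,+}^q+\rho_{i,-}^q)\bigr)^{1/q}$ for $q\in[1,\infty)$ and $\|\rho\|_\infty:=\max_i(\rho_{i,+}+\rho_{i,-})$. The $L_q$ distance of $x\in G$ from the identity is the minimal $L_q$ length of a path from the identity to $x$. $\mathcal B_q(R)$ is the set of $x\in G$ at $L_q$ distance at most $R$ from the identity, and for $\beta\in[0,1]$, the $L_q$ $\beta$-typical distance is $\min\{R\ge0:|\mathcal B_q(R)|\ge\beta|G|\}$ (infinite if there is no such $R$). Constants: $C^-_q:=2\,\Gamma(1/q+1)(qe)^{1/q}$, $C^+_q:=\frac12C^-_q$, $\mathfrak D^\pm_{N,q}:=k_N^{1/q}|G_N|^{1/k_N}/C^\pm_q$, where $q=\infty$ is interpreted as the limit $q\to\infty$ (so $C^-_\infty=2$, $C^+_\infty=1$). *)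

theory Defs
  imports "HOL-Probability.Probability" "HOL-Algebra.Algebra"
begin

section \<open>Cyclic decompositions\<close>

text \<open>The trivial factor \<open>\<int>\<^sub>1\<close> is allowed: it changes neither \<open>min_gens\<close> nor, for a non-trivial
  group, \<open>m_star\<close>, and it gives the trivial group a decomposition with at least one factor.
  Factors \<open>\<int>\<^sub>0 = \<int>\<close> are excluded.\<close>

definition cyclic_decomposition :: "('a, 'b) monoid_scheme \<Rightarrow> nat list \<Rightarrow> bool" where
  "cyclic_decomposition G ms \<longleftrightarrow>
     (\<forall>m\<in>set ms. 0 < m) \<and> G \<cong> product_group {..<length ms} (\<lambda>j. integer_mod_group (ms ! j))"

definition min_gens :: "('a, 'b) monoid_scheme \<Rightarrow> nat" where
  "min_gens G = (LEAST r. \<exists>ms. cyclic_decomposition G ms \<and> length ms = r)"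

definition m_star :: "('a, 'b) monoid_scheme \<Rightarrow> nat" where
  "m_star G = Max {Min (set ms) | ms. cyclic_decomposition G ms \<and> ms \<noteq> []}"


section \<open>Paths in Cayley graphs and typical distances\<close>

datatype orientation = Directed | Undirected

datatype sign = Pos | Neg

text \<open>The generators are \<open>z 0, \<dots>, z (k - 1)\<close>, possibly with repetitions. A path is the list of its
  steps; \<open>(i, Pos)\<close> uses \<open>z i\<close> and \<open>(i, Neg)\<close> uses its inverse. Edges are labelled by the
  generator used, so equal generators \<open>z i = z j\<close> and involutions give parallel edges.\<close>

inductive cayley_path ::
    "orientation \<Rightarrow> ('a, 'b) monoid_scheme \<Rightarrow> nat \<Rightarrow> (nat \<Rightarrow> 'a) \<Rightarrow> 'a \<Rightarrow> (nat \<times> sign) list \<Rightarrow> 'a \<Rightarrow> bool"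
  for s :: orientation and G :: "('a, 'b) monoid_scheme" and k :: nat and z :: "nat \<Rightarrow> 'a" where
  nil: "x \<in> carrier G \<Longrightarrow> cayley_path s G k z x [] x"
| forward: "x \<in> carrier G \<Longrightarrow> i < k \<Longrightarrow> cayley_path s G k z (x \<otimes>\<^bsub>G\<^esub> z i) \<rho> y \<Longrightarrow>
    cayley_path s G k z x ((i, Pos) # \<rho>) y"
| backward: "s = Undirected \<Longrightarrow> x \<in> carrier G \<Longrightarrow> i < k \<Longrightarrow>
    cayley_path s G k z (x \<otimes>\<^bsub>G\<^esub> inv\<^bsub>G\<^esub> z i) \<rho> y \<Longrightarrow> cayley_path s G k z x ((i, Neg) # \<rho>) y"

text \<open>The exponent \<open>q \<in> [1, \<infinity>]\<close> is an extended real; \<open>root_exp q\<close> is \<open>1 / q\<close>, with \<open>1 / \<infinity> = 0\<close>.\<close>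

definition root_exp :: "ereal \<Rightarrow> real" where
  "root_exp q = real_of_ereal (1 / q)"

definition Lq_length :: "ereal \<Rightarrow> nat \<Rightarrow> (nat \<times> sign) list \<Rightarrow> real" where
  "Lq_length q k \<rho> =
     (if q = \<infinity> then real (Max ((\<lambda>i. count_list \<rho> (i, Pos) + count_list \<rho> (i, Neg)) ` {..<k}))
      else (\<Sum>i<k. real (count_list \<rho> (i, Pos)) powr real_of_ereal q
                  + real (count_list \<rho> (i, Neg)) powr real_of_ereal q) powr root_exp q)"

text \<open>Both infima below are attained whenever they are finite, since only finitely many values of
  \<open>Lq_length q k\<close> lie below a given bound; they are \<open>\<infinity>\<close> when there is no admissible path or radius.\<close>

definition Lq_dist ::
    "orientation \<Rightarrow> ereal \<Rightarrow> ('a, 'b) monoid_scheme \<Rightarrow> nat \<Rightarrow> (nat \<Rightarrow> 'a) \<Rightarrow> 'a \<Rightarrow> ereal" where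
  "Lq_dist s q G k z x = Inf {ereal (Lq_length q k \<rho>) | \<rho>. cayley_path s G k z \<one>\<^bsub>G\<^esub> \<rho> x}"

definition Lq_ball ::
    "orientation \<Rightarrow> ereal \<Rightarrow> ('a, 'b) monoid_scheme \<Rightarrow> nat \<Rightarrow> (nat \<Rightarrow> 'a) \<Rightarrow> real \<Rightarrow> 'a set" where
  "Lq_ball s q G k z R = {x \<in> carrier G. Lq_dist s q G k z x \<le> ereal R}"

definition typical_dist ::
    "orientation \<Rightarrow> ereal \<Rightarrow> ('a, 'b) monoid_scheme \<Rightarrow> nat \<Rightarrow> (nat \<Rightarrow> 'a) \<Rightarrow> real \<Rightarrow> ereal" where
  "typical_dist s q G k z \<beta> =
     Inf {ereal R | R. 0 \<le> R \<and> \<beta> * real (order G) \<le> real (card (Lq_ball s q G k z R))}"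


section \<open>Constants\<close>

definition C_minus :: "ereal \<Rightarrow> real" where
  "C_minus q =
     (if q = \<infinity> then 2
      else 2 * Gamma (root_exp q + 1) * (real_of_ereal q * exp 1) powr root_exp q)"

fun C_const :: "orientation \<Rightarrow> ereal \<Rightarrow> real" where
  "C_const Undirected q = C_minus q"
| "C_const Directed q = C_minus q / 2"

definition D_const :: "orientation \<Rightarrow> ereal \<Rightarrow> ('a, 'b) monoid_scheme \<Rightarrow> nat \<Rightarrow> real" where
  "D_const s q G k =
     real k powr root_exp q * real (order G) powr (1 / real k) / C_const s q"

fun rank_bound :: "orientation \<Rightarrow> ereal" where
  "rank_bound Undirected = 1"
| "rank_bound Directed = 1 / 2"


section \<open>Random generators\<close>

definition iid_uniform ::
    "'w measure \<Rightarrow> ('a, 'b) monoid_scheme \<Rightarrow> nat \<Rightarrow> (nat \<Rightarrow> 'w \<Rightarrow> 'a) \<Rightarrow> bool" where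
  "iid_uniform M G k Z \<longleftrightarrow>
     prob_space M \<and>
     prob_space.indep_vars M (\<lambda>_. count_space (carrier G)) Z {..<k} \<and>
     (\<forall>i<k. distr M (count_space (carrier G)) (Z i) = uniform_count_measure (carrier G))"

text \<open>Each \<open>Y N\<close> lives on its own space \<open>M N\<close> and may be infinite with positive probability.\<close>

definition converges_in_prob :: "(nat \<Rightarrow> 'w measure) \<Rightarrow> (nat \<Rightarrow> 'w \<Rightarrow> ereal) \<Rightarrow> real \<Rightarrow> bool" where
  "converges_in_prob M Y c \<longleftrightarrow>
     (\<forall>\<epsilon>>0. (\<lambda>N. measure (M N) {\<omega> \<in> space (M N). ereal \<epsilon> < \<bar>Y N \<omega> - ereal c\<bar>}) \<longlonglongrightarrow> 0)"

end

theory Submission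
  imports Defs
begin

text \<open>The endpoint of a path depends only on its net coefficient vector \<open>v\<close>: it is \<open>\<Sum> v\<^sub>i z\<^sub>i\<close>. Hence the
  ball of radius \<open>R\<close> is covered by the coefficient vectors of \<open>L\<^sub>q\<close> norm at most \<open>R\<close>, whose number is
  at most \<open>(e\<^bsup>1/q\<^esup> + C R / k\<^bsup>1/q\<^esup>)\<^bsup>k\<^esup>\<close> by a Chernoff bound, \<open>C\<close> being the constant in
  \<open>\<DD> = k\<^bsup>1/q\<^esup> |G|\<^bsup>1/k\<^esup> / C\<close>. At radius \<open>(1 - \<epsilon>) \<DD>\<close> this is exponentially small in \<open>k\<close>
  compared with the order of the group, which is the lower bound.

  At radius \<open>(1 + \<epsilon>) \<DD>\<close> there are exponentially many more vectors than group elements, even among those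
  with entries of size \<open>O(|G|\<^bsup>1/k\<^esup>)\<close>. For uniform generators, two vectors whose difference has greatest
  common divisor \<open>g\<close> collide with probability at most \<open>g\<^bsup>d\<^esup> / |G|\<close>, where \<open>d\<close> is the rank, while
  a given vector is congruent modulo \<open>g\<close> to a fraction of only about \<open>g\<^bsup>-k\<^esup>\<close> of the others. As
  \<open>d < (1 - \<delta>) k\<close>, the expected number of collisions is asymptotically the least possible one, and by
  Cauchy--Schwarz almost all group elements are reached.\<close>

section \<open>Finite abelian groups are products of cyclic groups\<close>

text \<open>The fraction g^-k holds only up to a factor (1 + const * g / |G|^(1/k))^k: a ball shrunk
  by g has too many boundary points once its radius per coordinate is of constant size. For g of
  order |G|^(1/k) this factor is exponential in k. It is paid for by the surplus g^(delta k) left by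
  the rank: for small g the factor per coordinate is close to 1, and for large g a power of g beats
  any constant. This needs g / |G|^(1/k) to stay bounded, which is why the entries are truncated.
  Half of delta is spent here; the other half makes the sum over g exponentially small.

  The lower count of lattice points starts from Dirichlet's volume Gamma(1/q + 1)^k S^(k/q) /
  Gamma(k/q + 1) of the positive part of an L_q ball. A one-sided Stirling bound turns it into the
  growth rate of the Chernoff bound; this common rate is the origin of C.\<close>

lemma (in comm_group) ord_mult_coprime:
  assumes x: "x \<in> carrier G" and y: "y \<in> carrier G" and co: "coprime (ord x) (ord y)"
  shows "ord (x \<otimes> y) = ord x * ord y"
proof (rule dvd_antisym)
  show "ord (x \<otimes> y) dvd ord x * ord y"
    by (rule abelian_ord_mul_divides[OF x y])
  have *: "ord u dvd ord (u \<otimes> v)" if u: "u \<in> carrier G" and v: "v \<in> carrier G"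
    and "coprime (ord u) (ord v)" for u v
  proof -
    let ?n = "ord (u \<otimes> v) * ord v"
    have "(u \<otimes> v) [^] ?n = \<one>"
      using u v by (simp flip: nat_pow_pow)
    moreover have "(u \<otimes> v) [^] ?n = u [^] ?n \<otimes> v [^] ?n"
      using u v by (simp add: nat_pow_distrib)
    moreover have "v [^] ?n = \<one>"
      using v by (simp add: pow_eq_id)
    ultimately have "u [^] ?n = \<one>"
      using u by simp
    then have "ord u dvd ord (u \<otimes> v) * ord v"
      using u pow_eq_id by blast
    then show ?thesis
      using that(3) by (simp add: coprime_dvd_mult_left_iff)
  qed
  have "ord x dvd ord (x \<otimes> y)" "ord y dvd ord (x \<otimes> y)"
    using *[OF x y co] *[OF y x] co by (simp_all add: m_comm x y coprime_commute)
  then show "ord x * ord y dvd ord (x \<otimes> y)"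
    by (simp add: co divides_mult)
qed

text \<open>An element of maximal order works. If \<open>ord x\<close> did not divide
  \<open>ord a\<close>, some prime p would divide \<open>ord x\<close> to a higher power, and
  trading the p-part of \<open>a\<close> for that of \<open>x\<close> would give an element of
  larger order.\<close>

lemma (in comm_group) exists_pow_ord_eq_one:
  assumes fin: "finite (carrier G)"
  obtains a where "a \<in> carrier G" "\<And>x. x \<in> carrier G \<Longrightarrow> x [^] ord a = \<one>"
proof -
  have "finite (ord ` carrier G)" "ord ` carrier G \<noteq> {}"
    using fin by auto
  then have "Max (ord ` carrier G) \<in> ord ` carrier G"
    by (rule Max_in)
  then obtain a where a: "a \<in> carrier G" and max: "ord a = Max (ord ` carrier G)"
    by auto
  have le: "ord x \<le> ord a" if "x \<in> carrier G" for x
    using fin that by (simp add: max)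
  have "x [^] ord a = \<one>" if x: "x \<in> carrier G" for x
  proof (rule ccontr)
    assume "x [^] ord a \<noteq> \<one>"
    then have ndvd: "\<not> ord x dvd ord a"
      using x pow_eq_id by blast
    have pos: "0 < ord x" "0 < ord a"
      using ord_ge_1[OF fin x] ord_ge_1[OF fin a] by auto
    obtain p where p: "Factorial_Ring.prime p" and lt: "multiplicity p (ord a) < multiplicity p (ord x)"
      using ndvd pos by (metis multiplicity_le_imp_dvd not_less not_gr_zero)
    define i where "i = multiplicity p (ord a)"
    define j where "j = multiplicity p (ord x)"
    have dj: "p ^ j dvd ord x" and di: "p ^ i dvd ord a"
      unfolding i_def j_def by (rule multiplicity_dvd)+
    then obtain xj ai where xj: "ord x = p ^ j * xj" and ai: "ord a = p ^ i * ai"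
      by (auto elim!: dvdE)
    have p1: "1 < p" using p by (rule prime_gt_1_nat)
    have xj0: "0 < xj" and ai0: "0 < ai"
      using pos xj ai by auto
    let ?a = "a [^] (p ^ i)" and ?x = "x [^] xj"
    have oa: "ord ?a = ai"
      using ord_pow[OF a, of "p ^ i"] p1 ai by simp
    have ox: "ord ?x = p ^ j"
      using ord_pow[OF x, of xj] xj xj0 by simp
    have "\<not> p dvd ai"
    proof
      assume "p dvd ai"
      then have "p ^ Suc i dvd ord a"
        unfolding ai by (simp add: mult_dvd_mono mult.commute)
      then have "Suc i \<le> multiplicity p (ord a)"
        using pos p1 by (intro multiplicity_geI) auto
      then show False by (simp add: i_def)
    qed
    then have "coprime (ord ?a) (ord ?x)"
      unfolding oa ox using p prime_imp_coprime[of p ai] by (simp add: coprime_commute)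
    then have "ord (?a \<otimes> ?x) = ai * p ^ j"
      using ord_mult_coprime[of ?a ?x] a x oa ox by simp
    also have "\<dots> > ai * p ^ i"
      using lt p1 ai0 by (simp add: i_def j_def)
    finally have "ord a < ord (?a \<otimes> ?x)"
      by (simp add: ai mult.commute)
    then show False
      using le[of "?a \<otimes> ?x"] a x by simp
  qed
  then show thesis using a that by blast
qed

text \<open>The power found has prime order in the quotient by \<open>L\<close>. Its exponent is the
  least positive n with g^n in \<open>L\<close>, divided by a prime factor of n.\<close>

lemma (in group) prime_power_enters_subgroup:
  assumes fin: "finite (carrier G)" and L: "subgroup L G" and g: "g \<in> carrier G" "g \<notin> L"
  obtains h p :: nat where "Factorial_Ring.prime p" "g [^] h \<notin> L" "(g [^] h) [^] p \<in> L"
proof -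
  define P where "P n \<longleftrightarrow> 0 < n \<and> g [^] n \<in> L" for n :: nat
  define n where "n = (LEAST n. P n)"
  have "P (ord g)"
    using ord_ge_1[OF fin g(1)] g L by (simp add: P_def subgroup.one_closed)
  then have n: "P n" and least: "\<And>m. P m \<Longrightarrow> n \<le> m"
    unfolding n_def by (auto intro: LeastI Least_le)
  have "n \<noteq> 1"
    using n g by (auto simp: P_def)
  then obtain p where p: "Factorial_Ring.prime p" "p dvd n"
    using prime_factor_nat by blast
  have "n div p < n" "0 < n div p"
    using p n prime_gt_1_nat[OF p(1)] by (auto simp: P_def dvd_imp_le div_greater_zero_iff)
  then have "g [^] (n div p) \<notin> L"
    using least[of "n div p"] by (auto simp: P_def)
  moreover have "(g [^] (n div p)) [^] p \<in> L"
    using n p g by (simp add: nat_pow_pow P_def)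
  ultimately show thesis
    using that p by blast
qed

lemma (in comm_group) int_pow_enters_subgroup:
  assumes L: "subgroup L G" and g: "g \<in> carrier G" and "g [^] i \<in> L" "g [^] j \<in> L"
    and co: "coprime (i::int) j"
  shows "g \<in> L"
proof -
  obtain u v where uv: "u * i + v * j = 1"
    using bezout_int[of i j] co by auto
  have "g = g [^] (i * u + j * v)"
    using uv g by (simp add: mult.commute)
  also have "\<dots> = (g [^] i) [^] u \<otimes> (g [^] j) [^] v"
    using g by (simp add: int_pow_mult int_pow_pow)
  also have "\<dots> \<in> L"
    using subgroup.m_closed[OF L subgroup_int_pow_closed[OF L assms(3)] subgroup_int_pow_closed[OF L assms(4)]] .
  finally show ?thesis .
qed

text \<open>A subgroup that is maximal among those meeting the powers of \<open>a\<close> trivially is a complement.\<close>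

lemma (in comm_group) exists_complement_of_powers:
  assumes fin: "finite (carrier G)" and a: "a \<in> carrier G"
    and exponent: "\<And>x. x \<in> carrier G \<Longrightarrow> x [^] ord a = \<one>"
  defines "H \<equiv> range (\<lambda>n::int. a [^] n)"
  obtains K where "subgroup K G" "H \<inter> K \<subseteq> {\<one>}" "H <#> K = carrier G"
proof -
  have H: "subgroup H G"
    unfolding H_def by (rule subgroup_of_powers[OF a])
  define F where "F = {K. subgroup K G \<and> H \<inter> K \<subseteq> {\<one>}}"
  have "F \<subseteq> Pow (carrier G)"
    by (auto simp: F_def dest: subgroup.subset)
  then have "finite F"
    using fin by (meson finite_Pow_iff finite_subset)
  moreover have "{\<one>} \<in> F"
    by (simp add: F_def triv_subgroup)
  ultimately obtain K where "K \<in> F" and maxK: "\<And>B. B \<in> F \<Longrightarrow> K \<subseteq> B \<Longrightarrow> K = B"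
    using finite_has_maximal[of F] by blast
  then have K: "subgroup K G" and HK: "H \<inter> K \<subseteq> {\<one>}"
    by (auto simp: F_def)
  let ?L = "H <#> K"
  have L: "subgroup ?L G"
    by (rule mult_subgroups[OF H K])
  have inL: "x \<in> ?L" if "x \<in> H \<or> x \<in> K" for x
    using that
  proof
    assume "x \<in> H"
    then show ?thesis
      using subgroup.one_closed[OF K] subgroup.mem_carrier[OF H]
      by (force simp: set_mult_def)
  next
    assume "x \<in> K"
    then show ?thesis
      using subgroup.one_closed[OF H] subgroup.mem_carrier[OF K]
      by (force simp: set_mult_def)
  qed
  have "carrier G \<subseteq> ?L"
  proof (rule ccontr)
    assume "\<not> carrier G \<subseteq> ?L"
    then obtain g0 where "g0 \<in> carrier G" "g0 \<notin> ?L" by blast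
    then obtain h0 p :: nat where p: "Factorial_Ring.prime p" "g0 [^] h0 \<notin> ?L" "(g0 [^] h0) [^] p \<in> ?L"
      using prime_power_enters_subgroup[OF fin L] by metis
    define g where "g = g0 [^] h0"
    have g: "g \<in> carrier G" "g \<notin> ?L" "g [^] p \<in> ?L"
      using p \<open>g0 \<in> carrier G\<close> by (auto simp: g_def)
    then obtain j :: int and k where k: "k \<in> K" and gp: "g [^] p = a [^] j \<otimes> k"
      by (auto simp: set_mult_def H_def)
    have kc: "k \<in> carrier G"
      using K k by (rule subgroup.mem_carrier)
    \<comment> \<open>Otherwise g itself would lie in \<open>?L\<close>, because its p-th power and
      its power by the exponent \<open>ord a\<close> do.\<close>
    have "p dvd ord a"
    proof (rule ccontr)
      assume "\<not> p dvd ord a"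
      then have "coprime (int p) (int (ord a))"
        using p by (simp add: prime_imp_coprime)
      moreover have "g [^] int (ord a) \<in> ?L"
        using exponent[OF g(1)] by (simp add: int_pow_int subgroup.one_closed[OF L])
      moreover have "g [^] int p \<in> ?L"
        using g by (simp add: int_pow_int)
      ultimately show False
        using int_pow_enters_subgroup[OF L g(1)] g(2) by blast
    qed
    then obtain r where r: "ord a = p * r" ..
    have p0: "0 < p" using p by (simp add: prime_gt_0_nat)
    have r0: "0 < r" using r ord_ge_1[OF fin a] by (cases r) auto
    \<comment> \<open>The power r = ord a / p kills g^p, so a^(j r) lies in both \<open>H\<close>
      and \<open>K\<close> and is trivial. This forces p to divide j.\<close>
    have "\<one> = (a [^] j \<otimes> k) [^] int r"
      using exponent[OF g(1)] g by (simp add: r nat_pow_pow int_pow_int flip: gp)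
    also have "\<dots> = a [^] (j * int r) \<otimes> k [^] int r"
      using a kc by (simp add: int_pow_distrib int_pow_pow)
    finally have "a [^] (j * int r) = inv (k [^] int r)"
      using a kc by (metis int_pow_closed inv_equality)
    also have "\<dots> \<in> K"
      by (intro subgroup.m_inv_closed[OF K] subgroup_int_pow_closed[OF K] k)
    finally have "a [^] (j * int r) = \<one>"
      using HK by (auto simp: H_def)
    then have "int (ord a) dvd j * int r"
      using int_pow_eq_id[OF a] by blast
    then have "int p dvd j"
      using r0 by (simp add: r)
    then obtain j' where j': "j = int p * j'" ..
    \<comment> \<open>Dividing by a^j', a p-th root of a^j, brings the p-th power of g from
      \<open>?L\<close> into \<open>K\<close>, while h stays outside \<open>?L\<close>.\<close>
    define h where "h = g \<otimes> a [^] (- j')"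
    have h: "h \<in> carrier G"
      using g a by (simp add: h_def)
    have "h [^] int p = g [^] int p \<otimes> a [^] (- j)"
      using g a by (simp add: h_def int_pow_distrib int_pow_pow j' mult.commute)
    also have "\<dots> = a [^] j \<otimes> k \<otimes> inv (a [^] j)"
      using gp a by (simp add: int_pow_int int_pow_neg)
    also have "\<dots> = k"
      using a kc m_comm[of "a [^] j" k] by (simp add: m_assoc)
    finally have hp: "h [^] int p = k" .
    have hL: "h \<notin> ?L"
    proof
      assume "h \<in> ?L"
      moreover have "a [^] j' \<in> ?L"
        by (rule inL) (auto simp: H_def)
      ultimately have "h \<otimes> a [^] j' \<in> ?L"
        by (rule subgroup.m_closed[OF L])
      moreover have "h \<otimes> a [^] j' = g"
        using g a by (simp add: h_def int_pow_neg m_assoc)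
      ultimately show False using g by simp
    qed
    let ?K' = "K <#> range (\<lambda>n::int. h [^] n)"
    have K': "subgroup ?K' G"
      by (intro mult_subgroups K subgroup_of_powers h)
    have "x \<in> ?K'" if "x \<in> K" for x
      using that subgroup.mem_carrier[OF K that] 
      by (auto simp: set_mult_def intro!: bexI[of _ x] exI[of _ "0::int"])
    moreover have "h \<in> ?K'"
      using h subgroup.one_closed[OF K]
      by (auto simp: set_mult_def intro!: bexI[of _ "\<one>"] exI[of _ "1::int"])
    moreover have "h \<notin> K"
      using hL inL by blast
    \<comment> \<open>By maximality the larger subgroup meets \<open>H\<close> in some y = k' h^i
      other than the identity. If p divides i, then y lies in \<open>K\<close>; if not, h^p and h^i
      in \<open>?L\<close> put h into \<open>?L\<close>.\<close>
    ultimately have "?K' \<notin> F"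
      using maxK by blast
    then obtain y where y: "y \<in> H" "y \<in> ?K'" "y \<noteq> \<one>"
      using K' by (auto simp: F_def)
    then obtain k' and i :: int where k': "k' \<in> K" and yk: "y = k' \<otimes> h [^] i"
      by (auto simp: set_mult_def)
    have k'c: "k' \<in> carrier G"
      using K k' by (rule subgroup.mem_carrier)
    show False
    proof (cases "int p dvd i")
      case True
      then obtain i' where "i = int p * i'" ..
      then have "h [^] i = k [^] i'"
        using hp h by (simp flip: int_pow_pow)
      then have "y \<in> K"
        unfolding yk using K k k' by (simp add: subgroup.m_closed subgroup_int_pow_closed)
      then show False using HK y by auto
    next
      case False
      then have "coprime (int p) i"
        using p by (simp add: prime_imp_coprime)
      moreover have "h [^] int p \<in> ?L"
        using hp inL k by blast
      moreover have "h [^] i = inv k' \<otimes> y"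
        using k'c h unfolding yk by (simp flip: m_assoc)
      then have "h [^] i \<in> ?L"
        using k' y inL L by (simp add: subgroup.m_closed subgroup.m_inv_closed)
      ultimately show False
        using int_pow_enters_subgroup[OF L h] hL by blast
    qed
  qed
  then have "?L = carrier G"
    using subgroup.subset[OF L] by blast
  then show thesis
    using that K HK by blast
qed

lemma product_group_Suc_iso:
  "A 0 \<times>\<times> product_group {..<r} (\<lambda>j. A (Suc j)) \<cong> product_group {..<Suc r} A"
proof -
  let ?h = "\<lambda>(x, f). \<lambda>i\<in>{..<Suc r}. case i of 0 \<Rightarrow> x | Suc j \<Rightarrow> f j"
  have mem: "?h x \<in> carrier (product_group {..<Suc r} A)"
    if x: "x \<in> carrier (A 0 \<times>\<times> product_group {..<r} (\<lambda>j. A (Suc j)))" for x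
  proof -
    obtain a f where [simp]: "x = (a, f)" by fastforce
    have "(case i of 0 \<Rightarrow> a | Suc j \<Rightarrow> f j) \<in> carrier (A i)" if "i < Suc r" for i
      using x that by (cases i) (simp_all add: PiE_iff)
    then show ?thesis
      by (simp add: PiE_iff)
  qed
  have "?h \<in> iso (A 0 \<times>\<times> product_group {..<r} (\<lambda>j. A (Suc j))) (product_group {..<Suc r} A)"
  proof (rule isoI)
    show "?h \<in> hom (A 0 \<times>\<times> product_group {..<r} (\<lambda>j. A (Suc j))) (product_group {..<Suc r} A)"
    proof (rule homI)
      fix x y
      assume "x \<in> carrier (A 0 \<times>\<times> product_group {..<r} (\<lambda>j. A (Suc j)))"
        and "y \<in> carrier (A 0 \<times>\<times> product_group {..<r} (\<lambda>j. A (Suc j)))"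
      show "?h (x \<otimes>\<^bsub>A 0 \<times>\<times> product_group {..<r} (\<lambda>j. A (Suc j))\<^esub> y)
          = ?h x \<otimes>\<^bsub>product_group {..<Suc r} A\<^esub> ?h y"
      proof
        fix i
        show "?h (x \<otimes>\<^bsub>A 0 \<times>\<times> product_group {..<r} (\<lambda>j. A (Suc j))\<^esub> y) i
            = (?h x \<otimes>\<^bsub>product_group {..<Suc r} A\<^esub> ?h y) i"
          by (cases x; cases y; cases i) (simp_all add: mult_DirProd)
      qed
    qed (rule mem)
    show "bij_betw ?h (carrier (A 0 \<times>\<times> product_group {..<r} (\<lambda>j. A (Suc j))))
       (carrier (product_group {..<Suc r} A))"
    proof (rule bij_betwI[where g = "\<lambda>f. (f 0, \<lambda>j\<in>{..<r}. f (Suc j))"])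
      show "?h \<in> carrier (A 0 \<times>\<times> product_group {..<r} (\<lambda>j. A (Suc j))) \<rightarrow> carrier (product_group {..<Suc r} A)"
        using mem by blast
      show "(\<lambda>f. (f 0, \<lambda>j\<in>{..<r}. f (Suc j))) \<in> carrier (product_group {..<Suc r} A)
         \<rightarrow> carrier (A 0 \<times>\<times> product_group {..<r} (\<lambda>j. A (Suc j)))"
        by (simp add: PiE_iff Pi_iff Ball_def del: lessThan_Suc)
      fix x assume "x \<in> carrier (A 0 \<times>\<times> product_group {..<r} (\<lambda>j. A (Suc j)))"
      then show "(\<lambda>f. (f 0, \<lambda>j\<in>{..<r}. f (Suc j))) (?h x) = x"
        by (cases x) (simp add: fun_eq_iff restrict_def PiE_iff extensional_def)
    next
      fix f assume f: "f \<in> carrier (product_group {..<Suc r} A)"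
      show "?h ((\<lambda>f. (f 0, \<lambda>j\<in>{..<r}. f (Suc j))) f) = f"
      proof
        fix i
        show "?h ((\<lambda>f. (f 0, \<lambda>j\<in>{..<r}. f (Suc j))) f) i = f i"
          using PiE_arb[OF f[simplified], of i] by (cases i) auto
      qed
    qed
  qed
  then show ?thesis
    by (auto simp: is_iso_def)
qed

lemma (in group) powers_iso_integer_mod_group:
  assumes a: "a \<in> carrier G" and pos: "0 < ord a"
  shows "integer_mod_group (ord a) \<cong> subgroup_generated G (range (\<lambda>n::int. a [^] n))"
    (is "?Z \<cong> ?H")
proof -
  have car: "carrier ?H = range (\<lambda>n::int. a [^] n)"
    by (rule subgroup.carrier_subgroup_generated_subgroup[OF subgroup_of_powers[OF a]])
  have mod: "a [^] (n mod int (ord a)) = a [^] n" for n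
    using a by (simp add: int_pow_eq mod_eq_dvd_iff[symmetric])
  have "(\<lambda>n. a [^] n) \<in> iso ?Z ?H"
  proof (rule isoI)
    show "(\<lambda>n. a [^] n) \<in> hom ?Z ?H"
      using a by (auto simp: hom_def car mod int_pow_mult)
    show "bij_betw (\<lambda>n. a [^] n) (carrier ?Z) (carrier ?H)"
      unfolding bij_betw_def
    proof
      show "inj_on (\<lambda>n. a [^] n) (carrier ?Z)"
        using a pos by (auto simp: inj_on_def carrier_integer_mod_group int_pow_eq)
           (metis mod_eq_dvd_iff mod_pos_pos_trivial)
      show "(\<lambda>n. a [^] n) ` carrier ?Z = carrier ?H"
      proof
        show "carrier ?H \<subseteq> (\<lambda>n. a [^] n) ` carrier ?Z"
        proof (clarsimp simp: car)
          fix n :: int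
          show "a [^] n \<in> (\<lambda>n. a [^] n) ` carrier ?Z"
            using mod[of n] pos by (intro image_eqI[of _ _ "n mod int (ord a)"])
              (auto simp: carrier_integer_mod_group)
        qed
      qed (auto simp: car)
    qed
  qed
  then show ?thesis
    by (auto simp: is_iso_def)
qed

text \<open>Induction on the order: the powers of an element whose order is an exponent of the group
  split off, and the complement is smaller. The result makes \<open>min_gens\<close>, which is a
  \<open>LEAST\<close>, an attained length.\<close>

theorem exists_cyclic_decomposition:
  fixes G :: "('a, 'b) monoid_scheme"
  assumes "comm_group G" "finite (carrier G)"
  shows "\<exists>ms. cyclic_decomposition G ms"
  using assms
proof (induction "card (carrier G)" arbitrary: G rule: less_induct)
  case less
  interpret G: comm_group G by (rule less.prems)
  note fin = less.prems(2)
  obtain a where a: "a \<in> carrier G" and exponent: "\<And>x. x \<in> carrier G \<Longrightarrow> x [^]\<^bsub>G\<^esub> G.ord a = \<one>\<^bsub>G\<^esub>"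
    using G.exists_pow_ord_eq_one[OF fin] by blast
  let ?m = "G.ord a" and ?H = "range (\<lambda>n::int. a [^]\<^bsub>G\<^esub> n)"
  have m: "0 < ?m"
    using G.ord_ge_1[OF fin a] by simp
  show ?case
  proof (cases "a = \<one>\<^bsub>G\<^esub>")
    case True
    then have car: "carrier G = {\<one>\<^bsub>G\<^esub>}"
      using exponent by auto
    \<comment> \<open>The empty product has exactly one element, the function that is
      \<open>undefined\<close> everywhere.\<close>
    have "(\<lambda>_ _. undefined) \<in> iso G (product_group {..<length []} (\<lambda>j. integer_mod_group ([] ! j)))"
      by (rule isoI) (auto simp: hom_def car bij_betw_def)
    then show ?thesis
      by (auto simp: cyclic_decomposition_def is_iso_def intro!: exI[of _ "[]"])
  next
    case False
    obtain K where K: "subgroup K G" "?H \<inter> K \<subseteq> {\<one>\<^bsub>G\<^esub>}" "?H <#>\<^bsub>G\<^esub> K = carrier G"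
      using G.exists_complement_of_powers[OF fin a exponent] by blast
    have H: "subgroup ?H G"
      by (rule G.subgroup_of_powers[OF a])
    let ?K = "subgroup_generated G K"
    have carK: "carrier ?K = K"
      by (rule subgroup.carrier_subgroup_generated_subgroup[OF K(1)])
    have "a \<in> ?H"
      using a by (auto intro: range_eqI[of _ _ "1::int"])
    then have "a \<notin> K"
      using K(2) False by auto
    then have "K \<subset> carrier G"
      using subgroup.subset[OF K(1)] a by blast
    then have "card (carrier ?K) < card (carrier G)" "finite (carrier ?K)"
      unfolding carK using fin by (auto intro: psubset_card_mono finite_subset)
    moreover have "comm_group ?K"
      by (rule G.abelian_subgroup_generated[OF less.prems(1)])
    ultimately obtain ms where ms: "cyclic_decomposition ?K ms"
      using less.hyps by blast
    interpret HK: group_disjoint_sum G ?H K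
      using H K(1) by (simp add: group_disjoint_sum_def G.is_group)
    have "subgroup_generated G ?H \<times>\<times> ?K \<cong> G"
      using HK.iso_group_mul[OF less.prems(1)] K(2,3) by (auto simp: is_iso_def)
    then have "G \<cong> subgroup_generated G ?H \<times>\<times> ?K"
      by (rule group.iso_sym[rotated]) (simp add: DirProd_group)
    also have "\<dots> \<cong> integer_mod_group ?m \<times>\<times> product_group {..<length ms} (\<lambda>j. integer_mod_group (ms ! j))"
    proof (rule group.DirProd_iso_trans)
      show "group (subgroup_generated G ?H)" by simp
      show "subgroup_generated G ?H \<cong> integer_mod_group ?m"
        by (rule group.iso_sym[OF _ G.powers_iso_integer_mod_group[OF a m]]) simp
      show "?K \<cong> product_group {..<length ms} (\<lambda>j. integer_mod_group (ms ! j))"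
        using ms by (simp add: cyclic_decomposition_def)
    qed
    also have "\<dots> \<cong> product_group {..<length (?m # ms)} (\<lambda>j. integer_mod_group ((?m # ms) ! j))"
      using product_group_Suc_iso[of "\<lambda>j. integer_mod_group ((?m # ms) ! j)" "length ms"] by simp
    finally have "cyclic_decomposition G (?m # ms)"
      using ms m by (simp add: cyclic_decomposition_def)
    then show ?thesis ..
  qed
qed

section \<open>Linear equations in finite abelian groups\<close>

lemma nat_pow_product_group:
  assumes "\<And>i. i \<in> I \<Longrightarrow> group (A i)" "f \<in> carrier (product_group I A)" "i \<in> I"
  shows "(f [^]\<^bsub>product_group I A\<^esub> (n::nat)) i = f i [^]\<^bsub>A i\<^esub> n"
  using assms(3) by (induction n) simp_all

text \<open>A residue y with m dividing g y is determined by the quotient g y / m, which lies in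
  \<open>{0..<g}\<close>.\<close>

lemma card_torsion_integer_mod_group:
  fixes m g :: nat
  assumes "0 < m" "0 < g"
  shows "card {y \<in> {0..<int m}. (int g * y) mod int m = 0} \<le> g"
proof -
  let ?T = "{y \<in> {0..<int m}. (int g * y) mod int m = 0}"
  have "inj_on (\<lambda>y. int g * y div int m) ?T"
  proof (rule inj_onI)
    fix x y assume "x \<in> ?T" "y \<in> ?T" "int g * x div int m = int g * y div int m"
    then have "int g * x = int g * y"
      by (metis (mono_tags, lifting) div_mult_mod_eq mem_Collect_eq)
    then show "x = y" using assms by simp
  qed
  moreover have "(\<lambda>y. int g * y div int m) ` ?T \<subseteq> {0..<int g}"
  proof clarsimp
    fix y assume "0 \<le> y" "y < int m"
    then have "int g * y < int g * int m" "0 \<le> int g * y"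
      using assms by auto
    then show "0 \<le> int g * y div int m \<and> int g * y div int m < int g"
      using assms by (smt (verit) div_mult_mod_eq mult_right_less_imp_less of_nat_0_less_iff
          pos_imp_zdiv_nonneg_iff pos_mod_sign)
  qed
  ultimately have "card ?T \<le> card {0..<int g}"
    by (intro card_inj_on_le[of "\<lambda>y. int g * y div int m"]) auto
  then show ?thesis by simp
qed

lemma (in comm_group) card_torsion_le:
  assumes dec: "cyclic_decomposition G ms" and g: "0 < g"
  shows "card {x \<in> carrier G. x [^] (g::nat) = \<one>} \<le> g ^ length ms"
proof -
  let ?I = "{..<length ms}" and ?A = "\<lambda>j. integer_mod_group (ms ! j)"
  let ?P = "product_group ?I ?A"
  let ?T = "\<lambda>j. {y \<in> {0..<int (ms ! j)}. (int g * y) mod int (ms ! j) = 0}"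
  have pos: "0 < ms ! j" if "j < length ms" for j
    using dec that by (simp add: cyclic_decomposition_def)
  obtain h where h: "h \<in> iso G ?P"
    using dec by (auto simp: cyclic_decomposition_def is_iso_def)
  have grpP: "group ?P" by simp
  interpret h: group_hom G ?P h
    using h grpP by (simp add: group_hom_def group_hom_axioms_def iso_def is_group)
  have inj: "inj_on h (carrier G)"
    using h by (simp add: iso_def bij_betw_def)
  have sub: "h ` {x \<in> carrier G. x [^] g = \<one>} \<subseteq> PiE ?I ?T"
  proof (rule image_subsetI)
    fix x assume "x \<in> {x \<in> carrier G. x [^] g = \<one>}"
    then have x: "x \<in> carrier G" "x [^] g = \<one>" by auto
    then have hx: "h x \<in> carrier ?P"
      by (metis h.hom_closed)
    have "h x [^]\<^bsub>?P\<^esub> g = \<one>\<^bsub>?P\<^esub>"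
      using x by (metis h.hom_nat_pow h.hom_one)
    then have "(h x j) [^]\<^bsub>?A j\<^esub> g = 0" if "j < length ms" for j
      using nat_pow_product_group[of ?I ?A "h x" j g] hx that
      by (simp only: group_integer_mod_group lessThan_iff) simp
    then have "(int g * h x j) mod int (ms ! j) = 0" if "j < length ms" for j
      using that by simp
    then show "h x \<in> PiE ?I ?T"
      using hx pos by (auto simp: PiE_iff carrier_integer_mod_group split: if_split_asm)
  qed
  have "card {x \<in> carrier G. x [^] g = \<one>} \<le> card (PiE ?I ?T)"
    by (rule card_inj_on_le[OF inj_on_subset[OF inj] sub])
      (auto intro!: finite_PiE intro: finite_subset[of _ "{0..<int (ms ! j)}" for j])
  also have "\<dots> = (\<Prod>j\<in>?I. card (?T j))"
    by (rule card_PiE) simp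
  also have "\<dots> \<le> (\<Prod>j\<in>?I. g)"
    using pos g by (intro prod_mono conjI card_torsion_integer_mod_group) auto
  finally show ?thesis by simp
qed

lemma (in comm_group) card_torsion_le_min_gens:
  assumes "finite (carrier G)" "0 < g"
  shows "card {x \<in> carrier G. x [^] (g::nat) = \<one>} \<le> g ^ min_gens G"
proof -
  have "\<exists>r ms. cyclic_decomposition G ms \<and> length ms = r"
    using exists_cyclic_decomposition[OF comm_group_axioms assms(1)] by auto
  then have "\<exists>ms. cyclic_decomposition G ms \<and> length ms = min_gens G"
    unfolding min_gens_def by (rule LeastI_ex)
  then show ?thesis
    using card_torsion_le[OF _ assms(2)] by metis
qed

text \<open>All nonempty fibres are translates of the kernel.\<close>

lemma (in group_hom) card_image_kernel:
  assumes fin: "finite (carrier G)"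
  shows "card (h ` carrier G) * card (kernel G H h) = card (carrier G)"
proof -
  have fibre: "card {x \<in> carrier G. h x = h y} = card (kernel G H h)" if y: "y \<in> carrier G" for y
  proof (rule bij_betw_same_card[of "\<lambda>x. inv y \<otimes> x"])
    show "bij_betw (\<lambda>x. inv y \<otimes> x) {x \<in> carrier G. h x = h y} (kernel G H h)"
      by (rule bij_betwI[where g = "\<lambda>x. y \<otimes> x"]) (use y in \<open>auto simp: kernel_def simp flip: G.m_assoc\<close>)
  qed
  have "card (carrier G) = (\<Sum>y\<in>h ` carrier G. card {x \<in> carrier G. h x = y})"
    using sum.image_gen[OF fin, of "\<lambda>_. 1::nat" h] by simp
  also have "\<dots> = (\<Sum>y\<in>h ` carrier G. card (kernel G H h))"
    using fibre by (intro sum.cong) auto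
  finally show ?thesis by simp
qed

lemma bezout_Gcd_int:
  fixes v :: "'i \<Rightarrow> int"
  assumes "finite I"
  shows "\<exists>b. (\<Sum>i\<in>I. b i * v i) = Gcd (v ` I)"
  using assms
proof (induction I rule: finite_induct)
  case (insert j I)
  then obtain b where b: "(\<Sum>i\<in>I. b i * v i) = Gcd (v ` I)" by blast
  obtain s t where st: "s * v j + t * Gcd (v ` I) = gcd (v j) (Gcd (v ` I))"
    using bezout_int by blast
  let ?b = "\<lambda>i. if i = j then s else t * b i"
  have "(\<Sum>i\<in>insert j I. ?b i * v i) = s * v j + (\<Sum>i\<in>I. ?b i * v i)"
    using insert.hyps by simp
  also have "(\<Sum>i\<in>I. ?b i * v i) = (\<Sum>i\<in>I. t * (b i * v i))"
    using insert.hyps by (intro sum.cong) auto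
  also have "\<dots> = t * Gcd (v ` I)"
    by (simp add: b flip: sum_distrib_left)
  finally show ?case
    using st by (intro exI[of _ ?b]) simp
qed simp

definition lin_comb :: "('a, 'b) monoid_scheme \<Rightarrow> nat \<Rightarrow> (nat \<Rightarrow> 'a) \<Rightarrow> (nat \<Rightarrow> int) \<Rightarrow> 'a" where
  "lin_comb G k z v = (\<Otimes>\<^bsub>G\<^esub>i\<in>{..<k}. z i [^]\<^bsub>G\<^esub> v i)"

context comm_group
begin

lemma lin_comb_closed: "(\<And>i. i < k \<Longrightarrow> z i \<in> carrier G) \<Longrightarrow> lin_comb G k z v \<in> carrier G"
  unfolding lin_comb_def by (intro finprod_closed) auto

lemma lin_comb_cong:
  assumes "\<And>i. i < k \<Longrightarrow> z i \<in> carrier G" "\<And>i. i < k \<Longrightarrow> z' i = z i" "\<And>i. i < k \<Longrightarrow> v' i = v i"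
  shows "lin_comb G k z' v' = lin_comb G k z v"
  unfolding lin_comb_def by (rule finprod_cong') (use assms in auto)

lemma lin_comb_add:
  assumes "\<And>i. i < k \<Longrightarrow> z i \<in> carrier G"
  shows "lin_comb G k z (\<lambda>i. u i + v i) = lin_comb G k z u \<otimes> lin_comb G k z v"
proof -
  have "lin_comb G k z (\<lambda>i. u i + v i) = (\<Otimes>i\<in>{..<k}. z i [^] u i \<otimes> z i [^] v i)"
    unfolding lin_comb_def by (rule finprod_cong') (use assms in \<open>auto simp: int_pow_mult\<close>)
  also have "\<dots> = lin_comb G k z u \<otimes> lin_comb G k z v"
    unfolding lin_comb_def by (rule finprod_multf) (use assms in auto)
  finally show ?thesis .
qed

lemma lin_comb_eq_iff:
  assumes "\<And>i. i < k \<Longrightarrow> z i \<in> carrier G"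
  shows "lin_comb G k z u = lin_comb G k z v \<longleftrightarrow> lin_comb G k z (\<lambda>i. u i - v i) = \<one>"
proof -
  have "lin_comb G k z u = lin_comb G k z (\<lambda>i. u i - v i) \<otimes> lin_comb G k z v"
    using lin_comb_add[of k z "\<lambda>i. u i - v i" v] assms by simp
  then show ?thesis
    using lin_comb_closed[of k z v] lin_comb_closed[of k z "\<lambda>i. u i - v i"] assms
    by (simp add: l_cancel_one')
qed

lemma finprod_int_pow:
  assumes "finite I" "y \<in> carrier G"
  shows "(\<Otimes>i\<in>I. y [^] (f i :: int)) = y [^] (\<Sum>i\<in>I. f i)"
  using assms(1)
proof (induction I rule: finite_induct)
  case (insert j I)
  then show ?case
    using assms(2) by (subst finprod_insert) (auto simp: int_pow_mult)
qed simp

lemma card_lin_comb_kernel: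
  assumes fin: "finite (carrier G)" and nz: "\<exists>i<k. v i \<noteq> 0"
  defines "g \<equiv> nat (Gcd (v ` {..<k}))"
  shows "card {z \<in> {..<k} \<rightarrow>\<^sub>E carrier G. lin_comb G k z v = \<one>} * order G
           \<le> order G ^ k * card {x \<in> carrier G. x [^] g = \<one>}"
proof -
  let ?P = "product_group {..<k} (\<lambda>_. G)"
  let ?h = "\<lambda>z. lin_comb G k z v"
  have Z: "z i \<in> carrier G" if "z \<in> carrier ?P" "i < k" for z i
    using that by (auto simp: PiE_iff)
  have "?h \<in> hom ?P G"
  proof (rule homI)
    fix x y assume xy: "x \<in> carrier ?P" "y \<in> carrier ?P"
    have "?h (x \<otimes>\<^bsub>?P\<^esub> y) = (\<Otimes>i\<in>{..<k}. x i [^] v i \<otimes> y i [^] v i)"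
      unfolding lin_comb_def by (rule finprod_cong') (use Z xy in \<open>auto simp: int_pow_distrib\<close>)
    also have "\<dots> = ?h x \<otimes> ?h y"
      unfolding lin_comb_def by (rule finprod_multf) (use Z xy in auto)
    finally show "?h (x \<otimes>\<^bsub>?P\<^esub> y) = ?h x \<otimes> ?h y" .
  qed (use Z in \<open>auto intro: lin_comb_closed\<close>)
  then interpret h: group_hom ?P G ?h
    by (simp add: group_hom_def group_hom_axioms_def is_group)
  have "(\<lambda>x. x [^] g) \<in> hom G G"
    by (rule homI) (auto simp: nat_pow_distrib)
  then interpret p: group_hom G G "\<lambda>x. x [^] g"
    by (simp add: group_hom_def group_hom_axioms_def is_group)
  obtain b where b: "(\<Sum>i<k. b i * v i) = Gcd (v ` {..<k})"
    using bezout_Gcd_int[of "{..<k}" v] by auto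
  have gint: "int g = Gcd (v ` {..<k})"
    by (simp add: g_def)
  have sub: "(\<lambda>x. x [^] g) ` carrier G \<subseteq> ?h ` carrier ?P"
  proof clarify
    fix y assume y: "y \<in> carrier G"
    let ?z = "\<lambda>i\<in>{..<k}. y [^] b i"
    have "?h ?z = (\<Otimes>i\<in>{..<k}. y [^] (b i * v i))"
      unfolding lin_comb_def by (rule finprod_cong') (use y in \<open>auto simp: int_pow_pow\<close>)
    also have "\<dots> = y [^] g"
      using finprod_int_pow[of "{..<k}" y] y by (simp add: b int_pow_int flip: gint)
    finally show "y [^] g \<in> ?h ` carrier ?P"
      using y by (intro image_eqI[of _ _ ?z]) auto
  qed
  have finP: "finite (carrier ?P)"
    using fin by (auto intro: finite_PiE)
  have cP: "card (carrier ?P) = order G ^ k"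
    by (simp add: card_PiE order_def)
  have ker: "{z \<in> {..<k} \<rightarrow>\<^sub>E carrier G. ?h z = \<one>} = kernel ?P G ?h"
    by (simp add: kernel_def)
  have tor: "{x \<in> carrier G. x [^] g = \<one>} = kernel G G (\<lambda>x. x [^] g)"
    by (simp add: kernel_def)
  have "card (kernel ?P G ?h) * order G
      = card (kernel ?P G ?h) * card ((\<lambda>x. x [^] g) ` carrier G) * card (kernel G G (\<lambda>x. x [^] g))"
    using p.card_image_kernel[OF fin] by (simp add: order_def)
  also have "\<dots> \<le> card (kernel ?P G ?h) * card (?h ` carrier ?P) * card (kernel G G (\<lambda>x. x [^] g))"
    by (intro mult_le_mono card_mono sub finite_imageI finP order_refl)
  also have "\<dots> = order G ^ k * card (kernel G G (\<lambda>x. x [^] g))"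
    using h.card_image_kernel[OF finP] cP by (simp add: mult.commute)
  finally show ?thesis
    unfolding ker tor .
qed

end

section \<open>Counting lattice points\<close>

text \<open>The factor s^(1/q - 1) can blow up at 0. Therefore the fundamental theorem is applied
  with derivatives on the open interval only, continuity of the indefinite integral taking care of
  the endpoints.\<close>

lemma has_integral_powr_substitution:
  fixes f :: "real \<Rightarrow> real"
  assumes q: "0 < q" and M: "0 \<le> M" and cont: "continuous_on {0..} f"
    and int: "((\<lambda>s. f s * (s powr (1 / q - 1) / q)) has_integral J) {0..M powr q}"
  shows "((\<lambda>x. f (x powr q)) has_integral J) {0..M}"
proof -
  let ?h = "\<lambda>s. f s * (s powr (1 / q - 1) / q)" and ?c = "M powr q"
  let ?H = "\<lambda>y. integral {0..y} ?h"
  have h: "?h integrable_on {0..?c}"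
    using int by blast
  have "((\<lambda>x. f (x powr q)) has_integral (?H (M powr q) - ?H (0 powr q))) {0..M}"
  proof (rule fundamental_theorem_of_calculus_interior[OF M])
    show "continuous_on {0..M} (\<lambda>x. ?H (x powr q))"
    proof (rule continuous_on_compose2[OF indefinite_integral_continuous_1[OF h]])
      show "continuous_on {0..M} (\<lambda>x. x powr q)"
        using q by (intro continuous_on_powr') auto
      show "(\<lambda>x. x powr q) ` {0..M} \<subseteq> {0..?c}"
        using q by (auto intro!: powr_mono2)
    qed
  next
    fix x assume x: "x \<in> {0<..<M}"
    have s: "x powr q \<in> {0<..<?c}"
      using x q by (auto intro: powr_less_mono2)
    have "isCont f (x powr q)"
      using continuous_on_subset[OF cont, of "{0<..}"] s
      by (simp add: continuous_on_eq_continuous_at Ioi_le_Ico)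
    then have "isCont ?h (x powr q)"
      using s q by (intro continuous_intros) auto
    then have "(?H has_vector_derivative ?h (x powr q)) (at (x powr q) within {0..?c})"
      using integral_has_vector_derivative_continuous_at[OF h, of "x powr q" "{}"] s
      by (auto intro: continuous_at_imp_continuous_at_within)
    then have "(?H has_real_derivative ?h (x powr q)) (at (x powr q))"
      using s by (simp add: has_real_derivative_iff_has_vector_derivative at_within_Icc_at)
    moreover have "((\<lambda>x. x powr q) has_real_derivative q * x powr (q - 1)) (at x)"
      using x by (auto intro!: derivative_eq_intros)
    ultimately have "((\<lambda>x. ?H (x powr q)) has_real_derivative ?h (x powr q) * (q * x powr (q - 1))) (at x)"
      by (rule DERIV_chain2)
    moreover have "?h (x powr q) * (q * x powr (q - 1)) = f (x powr q)"
      using x q by (simp add: powr_powr field_simps flip: powr_add)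
    ultimately show "((\<lambda>x. ?H (x powr q)) has_vector_derivative f (x powr q)) (at x)"
      by (simp add: has_real_derivative_iff_has_vector_derivative)
  qed
  moreover have "?H (M powr q) = J"
    using int by (rule integral_unique)
  ultimately show ?thesis
    using q by simp
qed

lemma Riemann_sum_le_integral:
  fixes f :: "real \<Rightarrow> real"
  assumes anti: "\<And>x y. 0 \<le> x \<Longrightarrow> x \<le> y \<Longrightarrow> f y \<le> f x" and cont: "continuous_on {0..} f"
    and c: "0 \<le> c"
  shows "c * (\<Sum>u=1..m. f (c * real u)) \<le> integral {0..c * real m} f"
    and "integral {0..c * real m} f \<le> c * (\<Sum>u<m. f (c * real u))"
proof -
  have int: "f integrable_on {a..b}" if "0 \<le> a" for a b
    using that by (intro integrable_continuous_real continuous_on_subset[OF cont]) auto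
  have step: "integral {0..c * real (Suc m)} f = integral {0..c * real m} f + integral {c * real m..c * real (Suc m)} f"
    for m
    using c by (intro Henstock_Kurzweil_Integration.integral_combine[symmetric] int) (auto simp: algebra_simps)
  have lo: "c * f (c * real (Suc m)) \<le> integral {c * real m..c * real (Suc m)} f" for m
  proof -
    have "integral {c * real m..c * real (Suc m)} (\<lambda>_. f (c * real (Suc m))) \<le> integral {c * real m..c * real (Suc m)} f"
    proof (intro integral_le int)
      have m0: "0 \<le> c * real m" using c by simp
      then show "0 \<le> c * real m" .
      fix x assume "x \<in> {c * real m..c * real (Suc m)}"
      then show "f (c * real (Suc m)) \<le> f x"
        using m0 by (intro anti) auto
    qed (rule integrable_const_ivl)
    then show ?thesis using c by (simp add: algebra_simps)
  qed
  have up: "integral {c * real m..c * real (Suc m)} f \<le> c * f (c * real m)" for m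
  proof -
    have "integral {c * real m..c * real (Suc m)} f \<le> integral {c * real m..c * real (Suc m)} (\<lambda>_. f (c * real m))"
      using c by (intro integral_le int) (auto intro: anti)
    then show ?thesis using c by (simp add: algebra_simps)
  qed
  show "c * (\<Sum>u=1..m. f (c * real u)) \<le> integral {0..c * real m} f"
  proof (induction m)
    case (Suc m)
    then show ?case using step[of m] lo[of m] by (simp add: distrib_left)
  qed simp
  show "integral {0..c * real m} f \<le> c * (\<Sum>u<m. f (c * real u))"
  proof (induction m)
    case (Suc m)
    then show ?case using step[of m] up[of m] by (simp add: distrib_left)
  qed simp
qed

lemma Gamma_inverse_plus1:
  fixes q :: real
  assumes "0 < q"
  shows "Gamma (1 / q + 1) = Gamma (1 / q) / q"
proof -
  have "1 / q \<notin> \<int>\<^sub>\<le>\<^sub>0"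
    using assms nonpos_Ints_nonpos[of "1 / q"] by (auto simp: divide_le_0_iff)
  then show ?thesis
    using Gamma_plus1[of "1 / q"] by simp
qed

lemma integral_exp_powr_le:
  fixes q :: real
  assumes q: "0 < q" and M: "0 \<le> M"
  shows "integral {0..M} (\<lambda>x. exp (- (x powr q))) \<le> Gamma (1 / q + 1)"
proof -
  let ?h = "\<lambda>s. exp (- s) * (s powr (1 / q - 1) / q)"
  have full: "(?h has_integral Gamma (1 / q) / q) {0..}"
    using has_integral_divide[OF Gamma_integral_real[of "1 / q"], of q] q
    by (simp add: exp_minus field_simps)
  have int: "?h integrable_on {0..M powr q}"
    by (rule integrable_on_subinterval[OF has_integral_integrable[OF full]]) auto
  have "((\<lambda>x. exp (- (x powr q))) has_integral integral {0..M powr q} ?h) {0..M}"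
    by (rule has_integral_powr_substitution[OF q M]) (use int in \<open>auto intro!: continuous_intros simp: has_integral_integral\<close>)
  then have "integral {0..M} (\<lambda>x. exp (- (x powr q))) = integral {0..M powr q} ?h"
    by (rule integral_unique)
  also have "\<dots> \<le> integral {0..} ?h"
    using q by (intro integral_subset_le int has_integral_integrable[OF full]) auto
  also have "\<dots> = Gamma (1 / q) / q"
    using full by (rule integral_unique)
  also have "\<dots> = Gamma (1 / q + 1)"
    using Gamma_inverse_plus1[OF q] by simp
  finally show ?thesis .
qed

text \<open>The \<open>max 0\<close> extends the integrand to a continuous antitone function on the
  half line, the form in which \<open>Riemann_sum_le_integral\<close> takes it.\<close>

lemma integral_one_minus_powr:
  fixes q b :: real
  assumes q: "0 < q" and b: "0 < b"
  shows "((\<lambda>x. max 0 (1 - x powr q) powr b) has_integral Beta (1 / q) (b + 1) / q) {0..1}"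
proof (rule has_integral_powr_substitution[OF q])
  show "continuous_on {0..} (\<lambda>s. max 0 (1 - s) powr b)"
    using b by (intro continuous_on_powr' continuous_intros) auto
  have "((\<lambda>s. s powr (1 / q - 1) * (1 - s) powr (b + 1 - 1) / q) has_integral Beta (1 / q) (b + 1) / q) {0..1}"
    using q b by (intro has_integral_divide has_integral_Beta_real) auto
  then show "((\<lambda>s. max 0 (1 - s) powr b * (s powr (1 / q - 1) / q)) has_integral Beta (1 / q) (b + 1) / q) {0..1 powr q}"
    unfolding powr_one_eq_one by (rule has_integral_eq[rotated]) (auto simp: max_def)
qed simp

text \<open>A Stirling bound that loses a factor theta in the base. In the Gamma integral, t^x
  exp(-theta t) is bounded by its maximum, attained at t = x / theta, and the remaining exp(-(1 -
  theta) t) is integrated.\<close>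

lemma Gamma_plus1_le:
  fixes x \<theta> :: real
  assumes x: "0 < x" and \<theta>: "0 < \<theta>" "\<theta> < 1"
  shows "Gamma (x + 1) \<le> (x / (\<theta> * exp 1)) powr x / (1 - \<theta>)"
proof -
  have G: "((\<lambda>t. t powr x / exp t) has_integral Gamma (x + 1)) {0..}"
    using Gamma_integral_real[of "x + 1"] x by simp
  have E: "((\<lambda>t. (x / (\<theta> * exp 1)) powr x * exp (- (1 - \<theta>) * t)) has_integral
      (x / (\<theta> * exp 1)) powr x * (exp (- (1 - \<theta>) * 0) / (1 - \<theta>))) {0..}"
    using \<theta> by (intro has_integral_mult_right has_integral_exp_minus_to_infinity) auto
  have le: "t powr x / exp t \<le> (x / (\<theta> * exp 1)) powr x * exp (- (1 - \<theta>) * t)" if "t \<in> {0..}" for t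
  proof (cases "t = 0")
    case False
    then have t: "0 < t" using that by simp
    \<comment> \<open>The tangent bound for ln at 1 is an equality at t = x / theta, the
      maximiser.\<close>
    have "ln (\<theta> * t / x) \<le> \<theta> * t / x - 1"
      using t x \<theta> by (intro ln_le_minus_one) auto
    then have "x * ln (\<theta> * t / x) \<le> x * (\<theta> * t / x - 1)"
      using x by (intro mult_left_mono) auto
    then have "x * ln t \<le> x * (ln x - ln \<theta> - 1) + \<theta> * t"
      using t x \<theta> by (simp add: ln_mult ln_div algebra_simps)
    then have "exp (x * ln t - t) \<le> exp (x * (ln x - ln \<theta> - 1) + (- (1 - \<theta>) * t))"
      by (simp add: algebra_simps)
    then show ?thesis
      using t x \<theta> by (simp add: powr_def exp_diff exp_add ln_div ln_mult algebra_simps)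
  qed simp
  have "Gamma (x + 1) \<le> (x / (\<theta> * exp 1)) powr x * (exp (- (1 - \<theta>) * 0) / (1 - \<theta>))"
    by (rule has_integral_le[OF G E le])
  then show ?thesis by simp
qed

section \<open>Nonnegative lattice points with bounded sum of q-th powers\<close>

definition powr_sum :: "real \<Rightarrow> nat list \<Rightarrow> real" where
  "powr_sum q xs = (\<Sum>x\<leftarrow>xs. real x powr q)"

text \<open>These are the lattice points in the positive part of an L_q ball. The bound is on the
  q-th power of the norm, so that fixing one entry u merely shifts S by u^q.\<close>

definition powr_sum_lists :: "real \<Rightarrow> nat \<Rightarrow> real \<Rightarrow> nat list set" where
  "powr_sum_lists q k S = {xs. length xs = k \<and> powr_sum q xs \<le> S}"

lemma powr_sum_simps [simp]:
  "powr_sum q [] = 0" "powr_sum q (x # xs) = real x powr q + powr_sum q xs"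
  "powr_sum q (xs @ ys) = powr_sum q xs + powr_sum q ys"
  by (simp_all add: powr_sum_def)

lemma powr_sum_nonneg: "0 \<le> powr_sum q xs"
  by (induction xs) auto

lemma powr_le_powr_sum: "x \<in> set xs \<Longrightarrow> real x powr q \<le> powr_sum q xs"
proof (induction xs)
  case (Cons y ys)
  then show ?case
    using powr_sum_nonneg[of q ys] powr_ge_zero[of "real y" q] by (auto simp del: powr_ge_zero)
qed simp

lemma le_powr_self: "1 \<le> q \<Longrightarrow> real x \<le> real x powr q"
  using powr_mono[of 1 q "real x"] by (cases "x = 0") auto

lemma finite_powr_sum_lists:
  assumes "1 \<le> q"
  shows "finite (powr_sum_lists q k S)"
proof (rule finite_subset)
  show "powr_sum_lists q k S \<subseteq> {xs. set xs \<subseteq> {..nat \<lfloor>S\<rfloor>} \<and> length xs = k}"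
  proof (clarsimp simp: powr_sum_lists_def)
    fix xs x assume "powr_sum q xs \<le> S" "x \<in> set xs"
    then have "real x \<le> S"
      using le_powr_self[OF assms, of x] powr_le_powr_sum[of x xs q] by linarith
    then show "x \<le> nat \<lfloor>S\<rfloor>" by linarith
  qed
qed (simp add: finite_lists_length_eq)

lemma card_powr_sum_lists_0: "card (powr_sum_lists q 0 S) = of_bool (0 \<le> S)"
proof -
  have "powr_sum_lists q 0 S = (if 0 \<le> S then {[]} else {})"
    by (auto simp: powr_sum_lists_def)
  then show ?thesis by simp
qed

text \<open>As u <= u^q, the first entry is at most S. A cutoff m beyond that adds only empty sets,
  so one m can be kept while S decreases along the recursion.\<close>

lemma card_powr_sum_lists_Suc:
  assumes q: "1 \<le> q" and m: "S < real m + 1"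
  shows "card (powr_sum_lists q (Suc k) S) = (\<Sum>u\<le>m. card (powr_sum_lists q k (S - real u powr q)))"
proof -
  have "powr_sum_lists q (Suc k) S = (\<Union>u\<in>{..m}. Cons u ` powr_sum_lists q k (S - real u powr q))"
    (is "?L = ?R")
  proof
    show "?L \<subseteq> ?R"
    proof
      fix xs assume xs: "xs \<in> ?L"
      then obtain u ys where [simp]: "xs = u # ys"
        by (cases xs) (auto simp: powr_sum_lists_def)
      have "real u \<le> S"
        using xs le_powr_self[OF q, of u] powr_sum_nonneg[of q ys] by (simp add: powr_sum_lists_def)
      then have "u \<le> m" using m by linarith
      then show "xs \<in> ?R"
        using xs by (force simp: powr_sum_lists_def)
    qed
  qed (auto simp: powr_sum_lists_def)
  moreover have "card ?R = (\<Sum>u\<le>m. card (Cons u ` powr_sum_lists q k (S - real u powr q)))"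
    by (rule card_UN_disjoint) (auto simp: finite_powr_sum_lists[OF q])
  ultimately show ?thesis
    by (simp add: card_image)
qed

text \<open>The indicator of \<open>powr_sum q xs \<le> S\<close> is at most exp(t (S - powr_sum q
  xs)), which factorises over the entries.\<close>

lemma card_powr_sum_lists_Chernoff:
  assumes q: "1 \<le> q" and m: "S < real m + 1" and t: "0 \<le> t"
  shows "real (card (powr_sum_lists q k S)) \<le> exp (t * S) * (\<Sum>u\<le>m. exp (- t * real u powr q)) ^ k"
  using m
proof (induction k arbitrary: S)
  case 0
  then show ?case
    using t by (auto simp: card_powr_sum_lists_0)
next
  case (Suc k)
  let ?Z = "\<Sum>u\<le>m. exp (- t * real u powr q)"
  have "real (card (powr_sum_lists q (Suc k) S)) = (\<Sum>u\<le>m. real (card (powr_sum_lists q k (S - real u powr q))))"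
    using card_powr_sum_lists_Suc[OF q Suc.prems] by simp
  also have "\<dots> \<le> (\<Sum>u\<le>m. exp (t * (S - real u powr q)) * ?Z ^ k)"
  proof (rule sum_mono, rule Suc.IH)
    fix u show "S - real u powr q < real m + 1"
      using Suc.prems powr_ge_zero[of "real u" q] by linarith
  qed
  also have "\<dots> = exp (t * S) * ((\<Sum>u\<le>m. exp (- t * real u powr q)) * ?Z ^ k)"
    by (simp add: sum_distrib_left sum_distrib_right exp_diff exp_minus field_simps)
  finally show ?case by simp
qed

text \<open>The tilting parameter \<open>c = (q\<^sup>1\<^sup>/\<^sup>q \<rho>)\<^sup>-\<^sup>1\<close> minimises the Chernoff bound.\<close>

lemma card_powr_sum_lists_le:
  assumes q: "1 \<le> q" and \<rho>: "0 < \<rho>"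
  shows "real (card (powr_sum_lists q k (real k * \<rho> powr q)))
    \<le> (exp (1 / q) + Gamma (1 / q + 1) * (q * exp 1) powr (1 / q) * \<rho>) ^ k"
proof -
  let ?S = "real k * \<rho> powr q"
  define c where "c = 1 / (q powr (1 / q) * \<rho>)"
  define m where "m = nat \<lceil>?S\<rceil>"
  have c: "0 < c" using q \<rho> by (simp add: c_def)
  have cq: "c powr q = 1 / (q * \<rho> powr q)"
    using q \<rho> by (simp add: c_def powr_divide powr_mult powr_powr)
  have m: "?S < real m + 1"
    unfolding m_def by linarith
  have cu: "(c * real u) powr q = c powr q * real u powr q" for u
    using c by (simp add: powr_mult)
  have anti: "exp (- (y powr q)) \<le> exp (- (x powr q))" if "0 \<le> x" "x \<le> y" for x y
    using that q by (simp add: powr_mono2)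
  have cont: "continuous_on {0..} (\<lambda>x. exp (- (x powr q)))"
    using q by (intro continuous_intros continuous_on_powr') auto
  have "c * (\<Sum>u=1..m. exp (- ((c * real u) powr q))) \<le> integral {0..c * real m} (\<lambda>x. exp (- (x powr q)))"
    by (rule Riemann_sum_le_integral(1)[OF anti cont]) (use c in auto)
  also have "\<dots> \<le> Gamma (1 / q + 1)"
    using q c by (intro integral_exp_powr_le) auto
  finally have "(\<Sum>u=1..m. exp (- (c powr q) * real u powr q)) \<le> Gamma (1 / q + 1) / c"
    using c by (simp add: cu field_simps)
  \<comment> \<open>The integral does not cover the term u = 0. Its 1 becomes the additive exp(1/q)
    in the bound.\<close>
  moreover have "(\<Sum>u\<le>m. exp (- (c powr q) * real u powr q)) = 1 + (\<Sum>u=1..m. exp (- (c powr q) * real u powr q))"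
    by (simp add: atMost_atLeast0 sum.atLeast_Suc_atMost)
  ultimately have Z: "(\<Sum>u\<le>m. exp (- (c powr q) * real u powr q)) \<le> 1 + Gamma (1 / q + 1) / c"
    by simp
  have "real (card (powr_sum_lists q k ?S)) \<le> exp (c powr q * ?S) * (\<Sum>u\<le>m. exp (- (c powr q) * real u powr q)) ^ k"
    by (rule card_powr_sum_lists_Chernoff[OF q m]) simp
  also have "\<dots> \<le> exp (c powr q * ?S) * (1 + Gamma (1 / q + 1) / c) ^ k"
    using Z by (intro mult_left_mono power_mono) (auto intro: sum_nonneg)
  \<comment> \<open>Since c^q rho^q = 1/q, the tilt costs exp(1/q) per coordinate.\<close>
  also have "exp (c powr q * ?S) = exp (1 / q) ^ k"
    using q \<rho> by (simp add: cq field_simps flip: exp_of_nat_mult)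
  also have "exp (1 / q) ^ k * (1 + Gamma (1 / q + 1) / c) ^ k = (exp (1 / q) + exp (1 / q) * Gamma (1 / q + 1) / c) ^ k"
    by (simp add: distrib_left flip: power_mult_distrib)
  also have "exp (1 / q) * Gamma (1 / q + 1) / c = Gamma (1 / q + 1) * (q * exp 1) powr (1 / q) * \<rho>"
    using q by (simp add: c_def powr_mult exp_powr_real)
  finally show ?thesis .
qed

text \<open>The left side is the volume of the region of nonnegative x with sum of x_i^q at most S,
  which is covered by the unit cubes placed upwards from its lattice points. The induction slices by
  the first coordinate: the sum over slices is a left Riemann sum of an antitone function and so
  exceeds a Beta integral.\<close>

lemma card_powr_sum_lists_ge:
  assumes q: "1 \<le> q" and S: "0 \<le> S" and k: "0 < k"
  shows "Gamma (1 / q + 1) ^ k * S powr (real k / q) / Gamma (real k / q + 1)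
    \<le> real (card (powr_sum_lists q k S))"
  using k S
proof (induction k arbitrary: S rule: nat_induct_non_zero)
  case 1
  define r where "r = S powr (1 / q)"
  have "r powr q = S"
    using q 1 by (simp add: r_def powr_powr)
  have r0: "0 \<le> r" by (simp add: r_def)
  have "(\<lambda>u. [u]) ` {..nat \<lfloor>r\<rfloor>} \<subseteq> powr_sum_lists q 1 S"
  proof (clarsimp simp: powr_sum_lists_def)
    fix u assume "u \<le> nat \<lfloor>r\<rfloor>"
    then have "real u \<le> r" using r0 by linarith
    then have "real u powr q \<le> r powr q"
      using q by (intro powr_mono2) auto
    then show "real u powr q \<le> S" using \<open>r powr q = S\<close> by simp
  qed
  then have "card ((\<lambda>u. [u]) ` {..nat \<lfloor>r\<rfloor>}) \<le> card (powr_sum_lists q 1 S)"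
    by (intro card_mono finite_powr_sum_lists[OF q])
  then have "real (nat \<lfloor>r\<rfloor>) + 1 \<le> real (card (powr_sum_lists q 1 S))"
    by (simp add: card_image inj_on_def)
  \<comment> \<open>Counting 0 gives floor r + 1 points, which is at least r.\<close>
  then have "r \<le> real (card (powr_sum_lists q 1 S))"
    by linarith
  moreover have "Gamma (1 / q + 1) > 0"
    using q by (intro Gamma_real_pos add_nonneg_pos) auto
  ultimately show ?case by (simp add: r_def)
next
  case (Suc k)
  show ?case
  proof (cases "S = 0")
    case False
    then have S0: "0 < S" using Suc.prems by simp
    define r where "r = S powr (1 / q)"
    have r0: "0 < r" using S0 by (simp add: r_def)
    have rq: "r powr q = S"
      using q S0 by (simp add: r_def powr_powr)
    \<comment> \<open>The cutoff must exceed S for the recursion and r for the grid of mesh 1/r to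
      reach past 1.\<close>
    define m where "m = nat \<lceil>max r S\<rceil>"
    have m: "S < real m + 1" "r \<le> real (m + 1)"
      unfolding m_def by linarith+
    let ?f = "\<lambda>x. max 0 (1 - x powr q) powr (real k / q)"
    let ?V = "Gamma (1 / q + 1) ^ k / Gamma (real k / q + 1)"
    have V0: "0 \<le> ?V"
      using q by (intro divide_nonneg_pos zero_le_power Gamma_real_pos less_imp_le[OF Gamma_real_pos]) (auto intro: add_nonneg_pos)
    have kq: "0 < real k / q" using q Suc.hyps by simp
    have anti: "?f y \<le> ?f x" if "0 \<le> x" "x \<le> y" for x y
    proof -
      have "x powr q \<le> y powr q" using that q by (intro powr_mono2) auto
      then show ?thesis using kq by (intro powr_mono2) auto
    qed
    have cont: "continuous_on {0..} ?f"
      using q kq by (intro continuous_on_powr' continuous_intros) (auto simp: max_def)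
    have "Beta (1 / q) (real k / q + 1) / q = integral {0..1} ?f"
      using integral_one_minus_powr[of q "real k / q"] q kq by (simp add: integral_unique)
    also have "\<dots> \<le> integral {0..1 / r * real (m + 1)} ?f"
      using r0 m by (intro integral_subset_le integrable_continuous_real continuous_on_subset[OF cont])
        (auto simp: field_simps)
    also have "\<dots> \<le> 1 / r * (\<Sum>u<m + 1. ?f (1 / r * real u))"
      by (rule Riemann_sum_le_integral(2)[OF anti cont]) (use r0 in auto)
    finally have B: "r * (Beta (1 / q) (real k / q + 1) / q) \<le> (\<Sum>u\<le>m. ?f (1 / r * real u))"
      using r0 by (simp add: field_simps lessThan_Suc_atMost)
    have summand: "?V * (S powr (real k / q) * ?f (1 / r * real u)) \<le> real (card (powr_sum_lists q k (S - real u powr q)))"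
      for u
    proof (cases "real u powr q \<le> S")
      case True
      have "(1 / r * real u) powr q = real u powr q / S"
        using r0 by (simp add: powr_divide rq)
      moreover have "1 - real u powr q / S = (S - real u powr q) / S" "0 \<le> (S - real u powr q) / S"
        using True S0 by (auto simp: field_simps)
      ultimately have "max 0 (1 - (1 / r * real u) powr q) = (S - real u powr q) / S"
        by (simp only: max_def)  simp
      then have "S powr (real k / q) * ?f (1 / r * real u) = (S - real u powr q) powr (real k / q)"
        using True S0 by (simp add: powr_divide)
      then show ?thesis
        using Suc.IH[of "S - real u powr q"] True by (simp add: field_simps)
    next
      case False
      then have "1 \<le> (1 / r * real u) powr q"
        using r0 S0 by (simp add: powr_divide rq)
      then have "max 0 (1 - (1 / r * real u) powr q) = 0" by simp
      then show ?thesis by simp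
    qed
    \<comment> \<open>Expanding \<open>Beta\<close> into Gamma values exchanges Gamma(k/q + 1) for
      Gamma((k + 1)/q + 1), and Gamma(1/q)/q supplies the next factor Gamma(1/q + 1).\<close>
    have "Gamma (1 / q + 1) ^ Suc k * S powr (real (Suc k) / q) / Gamma (real (Suc k) / q + 1)
        = ?V * S powr (real k / q) * (r * (Beta (1 / q) (real k / q + 1) / q))"
    proof -
      have "Gamma (1 / q + 1) = Gamma (1 / q) / q"
        using q by (intro Gamma_inverse_plus1) simp
      moreover have "S powr (real (Suc k) / q) = S powr (real k / q) * r"
        unfolding r_def by (simp add: add_divide_distrib add.commute flip: powr_add)
      moreover have "Gamma (real k / q + 1) \<noteq> 0"
        using less_imp_neq[OF Gamma_real_pos[OF add_pos_pos[OF kq zero_less_one]]] by simp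
      moreover have "Gamma (1 / q + (real k / q + 1)) = Gamma (real (Suc k) / q + 1)"
        by (rule arg_cong[where f = Gamma]) (simp add: add_divide_distrib)
      ultimately show ?thesis
        unfolding Beta_def by (simp add: mult_ac del: of_nat_Suc)
    qed
    also have "\<dots> \<le> ?V * S powr (real k / q) * (\<Sum>u\<le>m. ?f (1 / r * real u))"
      by (intro mult_left_mono B mult_nonneg_nonneg V0) auto
    also have "\<dots> = (\<Sum>u\<le>m. ?V * (S powr (real k / q) * ?f (1 / r * real u)))"
      by (simp add: sum_distrib_left mult.assoc)
    also have "\<dots> \<le> (\<Sum>u\<le>m. real (card (powr_sum_lists q k (S - real u powr q))))"
      by (intro sum_mono summand)
    also have "\<dots> = real (card (powr_sum_lists q (Suc k) S))"
      using card_powr_sum_lists_Suc[OF q m(1)] by simp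
    finally show ?thesis .
  qed simp
qed

lemma powr_mult_power_conv:
  fixes x y :: real
  assumes "0 < x"
  shows "x powr (real k * y) = (x powr y) ^ k"
  using assms by (simp add: powr_power mult.commute)

text \<open>The Stirling bound turns the volume into a pure k-th power with the same base as in
  \<open>card_powr_sum_lists_le\<close>, apart from the factor 1 - eta and the additive term
  there.\<close>

lemma exists_card_powr_sum_lists_ge:
  assumes q: "1 \<le> q" and \<eta>: "0 < \<eta>" "\<eta> < 1"
  obtains k0 where "0 < k0" "\<And>k \<rho>. k0 \<le> k \<Longrightarrow> 0 < \<rho> \<Longrightarrow>
    ((1 - \<eta>) * (Gamma (1 / q + 1) * (q * exp 1) powr (1 / q) * \<rho>)) ^ k
      \<le> real (card (powr_sum_lists q k (real k * \<rho> powr q)))"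
proof -
  \<comment> \<open>Any value strictly between 1 - eta and 1 serves: ((1 - eta) / theta)^k decays
    and absorbs the constant 1 / (1 - theta) of \<open>Gamma_plus1_le\<close>.\<close>
  define \<theta> where "\<theta> = 1 - \<eta> / 2"
  have \<theta>: "0 < \<theta>" "\<theta> < 1" "1 - \<eta> < \<theta>"
    using \<eta> by (auto simp: \<theta>_def)
  let ?\<Gamma> = "Gamma (1 / q + 1)"
  have G0: "0 < ?\<Gamma>"
    using q by (intro Gamma_real_pos add_nonneg_pos) auto
  have "(\<lambda>k. ((1 - \<eta>) / \<theta>) ^ k) \<longlonglongrightarrow> 0"
    using \<theta> \<eta> by (intro LIMSEQ_power_zero) auto
  then have "\<forall>\<^sub>F k in sequentially. ((1 - \<eta>) / \<theta>) ^ k < 1 - \<theta>"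
    using \<theta> by (intro order_tendstoD) auto
  then obtain K where K: "\<And>k. K \<le> k \<Longrightarrow> ((1 - \<eta>) / \<theta>) ^ k < 1 - \<theta>"
    by (auto simp: eventually_sequentially)
  have "((1 - \<eta>) * (?\<Gamma> * (q * exp 1) powr (1 / q) * \<rho>)) ^ k
      \<le> real (card (powr_sum_lists q k (real k * \<rho> powr q)))" if k: "Suc K \<le> k" and \<rho>: "0 < \<rho>" for k \<rho>
  proof -
    have k0: "0 < k" using k by simp
    let ?x = "real k / q"
    have x0: "0 < ?x" using k0 q by simp
    have gx: "0 < Gamma (?x + 1)"
      using x0 by (intro Gamma_real_pos) auto
    have "((1 - \<eta>) / \<theta>) ^ k \<le> 1 - \<theta>"
      using K[of k] k by simp
    then have "(1 - \<eta>) ^ k \<le> (1 - \<theta>) * \<theta> ^ k"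
      using \<theta> by (simp add: power_divide divide_le_eq)
    also have "\<theta> ^ k \<le> \<theta> powr ?x"
    proof -
      have "?x \<le> real k" using q k0 by (simp add: divide_le_eq)
      then have "\<theta> powr real k \<le> \<theta> powr ?x"
        using \<theta> by (intro powr_mono') auto
      then show ?thesis using \<theta> by (simp add: powr_realpow)
    qed
    finally have base: "(1 - \<eta>) ^ k \<le> (1 - \<theta>) * \<theta> powr ?x"
      using \<theta> by simp
    have "((1 - \<eta>) * (?\<Gamma> * (q * exp 1) powr (1 / q) * \<rho>)) ^ k
        = (1 - \<eta>) ^ k * (?\<Gamma> ^ k * (q * exp 1) powr ?x * \<rho> ^ k)"
      using q powr_mult_power_conv[of "q * exp 1" k "1 / q"] by (simp add: power_mult_distrib)
    also have "\<dots> \<le> (1 - \<theta>) * \<theta> powr ?x * (?\<Gamma> ^ k * (q * exp 1) powr ?x * \<rho> ^ k)"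
      using base G0 \<rho> by (intro mult_right_mono) auto
    also have "\<dots> = ?\<Gamma> ^ k * (real k powr ?x * \<rho> ^ k) / ((?x / (\<theta> * exp 1)) powr ?x / (1 - \<theta>))"
      using \<theta> q k0 by (simp add: powr_divide powr_mult field_simps)
    also have "real k powr ?x * \<rho> ^ k = (real k * \<rho> powr q) powr ?x"
      using \<rho> q by (simp add: powr_mult powr_powr powr_realpow)
    also have "?\<Gamma> ^ k * (real k * \<rho> powr q) powr ?x / ((?x / (\<theta> * exp 1)) powr ?x / (1 - \<theta>))
        \<le> ?\<Gamma> ^ k * (real k * \<rho> powr q) powr ?x / Gamma (?x + 1)"
      using G0 gx by (intro divide_left_mono Gamma_plus1_le x0 \<theta> mult_nonneg_nonneg mult_pos_pos)
        (use x0 \<theta> k0 q gx in \<open>auto simp del: Gamma_real_pos intro: gx\<close>)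
    also have "\<dots> \<le> real (card (powr_sum_lists q k (real k * \<rho> powr q)))"
      by (rule card_powr_sum_lists_ge[OF q _ k0]) simp
    finally show ?thesis .
  qed
  then show thesis using that[of "Suc K"] by simp
qed

lemma card_bounded_powr_sum_lists_mult:
  assumes q: "1 \<le> q"
  shows "card {xs \<in> powr_sum_lists q k S. \<forall>x\<in>set xs. real x \<le> T} *
      card {xs \<in> powr_sum_lists q k' S'. \<forall>x\<in>set xs. real x \<le> T}
    \<le> card {xs \<in> powr_sum_lists q (k + k') (S + S'). \<forall>x\<in>set xs. real x \<le> T}"
    (is "card ?A * card ?B \<le> card ?C")
proof -
  have "card (?A \<times> ?B) \<le> card ?C"
  proof (rule card_inj_on_le)
    show "inj_on (\<lambda>(xs, ys). xs @ ys) (?A \<times> ?B)"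
      by (auto simp: inj_on_def powr_sum_lists_def)
    show "(\<lambda>(xs, ys). xs @ ys) ` (?A \<times> ?B) \<subseteq> ?C"
      by (auto simp: powr_sum_lists_def)
    show "finite ?C"
      using finite_powr_sum_lists[OF q] by simp
  qed
  then show ?thesis by (simp add: card_cartesian_product)
qed

text \<open>Splitting the coordinates into blocks of bounded length, each lying in a ball of its own, keeps
  all entries below a multiple of \<open>\<rho>\<close> at no cost in the exponential growth rate.\<close>

lemma exists_card_bounded_powr_sum_lists_ge:
  assumes q: "1 \<le> q" and \<eta>: "0 < \<eta>" "\<eta> < 1"
  obtains k0 L where "0 < L" "\<And>k \<rho>. k0 \<le> k \<Longrightarrow> 0 < \<rho> \<Longrightarrow>
    ((1 - \<eta>) * (Gamma (1 / q + 1) * (q * exp 1) powr (1 / q) * \<rho>)) ^ k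
      \<le> real (card {xs \<in> powr_sum_lists q k (real k * \<rho> powr q). \<forall>x\<in>set xs. real x \<le> L * \<rho>})"
proof -
  obtain k0 where k0: "0 < k0" and lo: "\<And>k \<rho>. k0 \<le> k \<Longrightarrow> 0 < \<rho> \<Longrightarrow>
    ((1 - \<eta>) * (Gamma (1 / q + 1) * (q * exp 1) powr (1 / q) * \<rho>)) ^ k
      \<le> real (card (powr_sum_lists q k (real k * \<rho> powr q)))"
    using exists_card_powr_sum_lists_ge[OF q \<eta>] by blast
  \<comment> \<open>Blocks have length below 2 k0, and an entry of a block of length k is at most
    k^(1/q) rho <= k rho.\<close>
  define L where "L = 2 * real k0"
  let ?c = "\<lambda>\<rho>. (1 - \<eta>) * (Gamma (1 / q + 1) * (q * exp 1) powr (1 / q) * \<rho>)"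
  let ?A = "\<lambda>k \<rho>. {xs \<in> powr_sum_lists q k (real k * \<rho> powr q). \<forall>x\<in>set xs. real x \<le> L * \<rho>}"
  have c0: "0 \<le> ?c \<rho>" if "0 < \<rho>" for \<rho>
    using that \<eta> q by (intro mult_nonneg_nonneg less_imp_le[OF Gamma_real_pos]) (auto intro: add_nonneg_pos)
  have small: "?c \<rho> ^ k \<le> real (card (?A k \<rho>))" if k: "k0 \<le> k" "k < 2 * k0" and \<rho>: "0 < \<rho>" for k \<rho>
  proof -
    have "real x \<le> L * \<rho>" if xs: "xs \<in> powr_sum_lists q k (real k * \<rho> powr q)" "x \<in> set xs" for xs x
    proof -
      have "real x powr q \<le> real k * \<rho> powr q"
        using xs powr_le_powr_sum[of x xs q] by (simp add: powr_sum_lists_def)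
      also have "real k \<le> real k powr q"
        by (rule le_powr_self[OF q])
      also have "real k powr q \<le> L powr q"
        using k q by (intro powr_mono2) (auto simp: L_def)
      finally have "real x powr q \<le> (L * \<rho>) powr q"
        using \<rho> k0 by (simp add: powr_mult L_def)
      then show ?thesis
        using q \<rho> k0 powr_less_mono2[of q "L * \<rho>" "real x"] by (force simp: L_def)
    qed
    then have "?A k \<rho> = powr_sum_lists q k (real k * \<rho> powr q)"
      by blast
    then show ?thesis
      using lo[OF k(1) \<rho>] by simp
  qed
  have "?c \<rho> ^ k \<le> real (card (?A k \<rho>))" if k: "k0 \<le> k" and \<rho>: "0 < \<rho>" for k \<rho>
    using k
  proof (induction k rule: less_induct)
    case (less k)
    show ?case
    proof (cases "k < 2 * k0")
      case True
      then show ?thesis using small less.prems \<rho> by blast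
    next
      case False
      \<comment> \<open>Blocks of length k0 are peeled off as long as at least k0 coordinates
        remain, so the last block has length between k0 and 2 k0.\<close>
      define j where "j = k - k0"
      have j: "k = k0 + j" "k0 \<le> j" "j < k"
        using False k0 by (auto simp: j_def)
      have "?c \<rho> ^ k = ?c \<rho> ^ k0 * ?c \<rho> ^ j"
        by (simp add: j power_add)
      also have "\<dots> \<le> real (card (?A k0 \<rho>)) * real (card (?A j \<rho>))"
        using c0[OF \<rho>] by (intro mult_mono small less.IH j \<rho>) (use k0 in auto)
      also have "\<dots> \<le> real (card (?A k \<rho>))"
        using card_bounded_powr_sum_lists_mult[OF q, of k0 "real k0 * \<rho> powr q" "L * \<rho>" j "real j * \<rho> powr q"]
        unfolding j of_nat_add distrib_right of_nat_mult[symmetric] of_nat_le_iff .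
      finally show ?thesis .
    qed
  qed
  then show thesis
    using that[of L k0] k0 by (simp add: L_def)
qed

section \<open>Balls with normalised radius, uniformly in q\<close>

text \<open>The L_q norm is at most k^(1/q) rho. With this normalisation the cardinality grows like
  (C rho)^k, and q = \<infinity> obeys the same formulas as finite q.\<close>

definition qball :: "ereal \<Rightarrow> nat \<Rightarrow> real \<Rightarrow> nat list set" where
  "qball q k \<rho> = (if q = \<infinity> then {xs. length xs = k \<and> (\<forall>x\<in>set xs. real x \<le> \<rho>)}
     else powr_sum_lists (real_of_ereal q) k (real k * \<rho> powr real_of_ereal q))"

lemma root_exp_ereal: "1 \<le> q \<Longrightarrow> root_exp (ereal q) = 1 / q"
  unfolding root_exp_def one_ereal_def by simp

lemma root_exp_infinity [simp]: "root_exp \<infinity> = 0"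
  by (simp add: root_exp_def)

lemma C_const_Directed_ereal:
  "1 \<le> q \<Longrightarrow> C_const Directed (ereal q) = Gamma (1 / q + 1) * (q * exp 1) powr (1 / q)"
  by (simp add: C_minus_def root_exp_ereal)

lemma C_const_Directed_infinity: "C_const Directed \<infinity> = 1"
  by (simp add: C_minus_def)

lemma C_const_pos:
  assumes "1 \<le> q"
  shows "0 < C_const s q"
proof -
  have "0 < C_const Directed q"
  proof (cases q)
    case (real r)
    then show ?thesis
      using assms by (auto simp: C_const_Directed_ereal simp del: C_const.simps intro!: mult_pos_pos Gamma_real_pos add_nonneg_pos)
  next
    case PInf
    then show ?thesis by (simp add: C_minus_def)
  qed (use assms in auto)
  then show ?thesis by (cases s) simp_all
qed

lemma qball_infinity: "0 \<le> \<rho> \<Longrightarrow> qball \<infinity> k \<rho> = {xs. set xs \<subseteq> {..nat \<lfloor>\<rho>\<rfloor>} \<and> length xs = k}"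
  by (auto simp: qball_def subset_iff le_nat_iff le_floor_iff)

lemma finite_qball:
  assumes "1 \<le> q"
  shows "finite (qball q k \<rho>)"
proof (cases q)
  case (real r)
  then show ?thesis
    using assms finite_powr_sum_lists[of r] by (simp add: qball_def)
next
  case PInf
  have "qball q k \<rho> \<subseteq> qball \<infinity> k \<bar>\<rho>\<bar>"
    using PInf by (auto simp: qball_def)
  moreover have "finite (qball \<infinity> k \<bar>\<rho>\<bar>)"
    by (simp add: qball_infinity finite_lists_length_eq)
  ultimately show ?thesis by (rule finite_subset)
qed (use assms in auto)

lemma card_qball_le:
  assumes q: "1 \<le> q" and \<rho>: "0 < \<rho>"
  shows "real (card (qball q k \<rho>)) \<le> (exp (root_exp q) + C_const Directed q * \<rho>) ^ k"
proof (cases q)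
  case (real r)
  then show ?thesis
    using q \<rho> card_powr_sum_lists_le[of r \<rho> k]
    by (simp add: qball_def root_exp_ereal C_const_Directed_ereal del: C_const.simps)
next
  case PInf
  have "real (card (qball q k \<rho>)) = (real (nat \<lfloor>\<rho>\<rfloor>) + 1) ^ k"
    using \<rho> PInf by (simp add: qball_infinity card_lists_length_eq add.commute)
  also have "\<dots> \<le> (1 + \<rho>) ^ k"
    using \<rho> by (intro power_mono) linarith+
  finally show ?thesis
    using PInf by (simp add: C_const_Directed_infinity del: C_const.simps)
qed (use q in auto)

lemma exists_card_bounded_qball_ge:
  assumes q: "1 \<le> q" and \<eta>: "0 < \<eta>" "\<eta> < 1"
  obtains k0 L where "0 < L" "\<And>k \<rho>. k0 \<le> k \<Longrightarrow> 0 < \<rho> \<Longrightarrow>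
    ((1 - \<eta>) * (C_const Directed q * \<rho>)) ^ k
      \<le> real (card {xs \<in> qball q k \<rho>. \<forall>x\<in>set xs. real x \<le> L * \<rho>})"
proof (cases q)
  case (real r)
  then have r: "1 \<le> r" using q by simp
  show thesis
  proof (rule exists_card_bounded_powr_sum_lists_ge[OF r \<eta>])
    fix k0 and L :: real
    assume L: "0 < L" and ge: "\<And>k \<rho>. k0 \<le> k \<Longrightarrow> 0 < \<rho> \<Longrightarrow>
      ((1 - \<eta>) * (Gamma (1 / r + 1) * (r * exp 1) powr (1 / r) * \<rho>)) ^ k
        \<le> real (card {xs \<in> powr_sum_lists r k (real k * \<rho> powr r). \<forall>x\<in>set xs. real x \<le> L * \<rho>})"
    show thesis
    proof (rule that[OF L])
      fix k and \<rho> :: real assume "k0 \<le> k" "0 < \<rho>"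
      from ge[OF this] show "((1 - \<eta>) * (C_const Directed q * \<rho>)) ^ k
          \<le> real (card {xs \<in> qball q k \<rho>. \<forall>x\<in>set xs. real x \<le> L * \<rho>})"
        unfolding real C_const_Directed_ereal[OF r] by (simp add: qball_def)
    qed
  qed
next
  case PInf
  \<comment> \<open>For q = \<infinity> the ball itself bounds the entries, so L = 1.\<close>
  have "((1 - \<eta>) * (C_const Directed q * \<rho>)) ^ k
      \<le> real (card {xs \<in> qball q k \<rho>. \<forall>x\<in>set xs. real x \<le> 1 * \<rho>})" if "0 < \<rho>" for k \<rho>
  proof -
    have "((1 - \<eta>) * \<rho>) ^ k \<le> (real (nat \<lfloor>\<rho>\<rfloor>) + 1) ^ k"
    proof (rule power_mono)
      have "(1 - \<eta>) * \<rho> \<le> \<rho>" using \<eta> that by simp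
      then show "(1 - \<eta>) * \<rho> \<le> real (nat \<lfloor>\<rho>\<rfloor>) + 1" by linarith
    qed (use \<eta> that in auto)
    also have "\<dots> = real (card (qball q k \<rho>))"
      using that PInf by (simp add: qball_infinity card_lists_length_eq add.commute)
    also have "qball q k \<rho> = {xs \<in> qball q k \<rho>. \<forall>x\<in>set xs. real x \<le> 1 * \<rho>}"
      using PInf by (auto simp: qball_def)
    finally show ?thesis
      using PInf by (simp add: C_const_Directed_infinity del: C_const.simps)
  qed
  then show thesis using that[of 1 0] by simp
qed (use q in auto)

section \<open>Collisions of linear combinations\<close>

text \<open>The gcd of v is 1 or one of the numbers 2, ..., B. Summing over all common divisors
  instead of using the gcd replaces it by divisibility indicators, which later add up to sizes of
  residue classes.\<close>

lemma (in comm_group) order_mult_card_lin_comb_kernel_le: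
  assumes fin: "finite (carrier G)" and bd: "\<And>i. i < k \<Longrightarrow> \<bar>v i\<bar> \<le> int B" and nz: "\<exists>i<k. v i \<noteq> 0"
  shows "order G * card {z \<in> {..<k} \<rightarrow>\<^sub>E carrier G. lin_comb G k z v = \<one>}
     \<le> order G ^ k * (1 + (\<Sum>g\<in>{2..B}. g ^ min_gens G * of_bool (\<forall>i<k. int g dvd v i)))"
proof -
  define g where "g = nat (Gcd (v ` {..<k}))"
  obtain i where i: "i < k" "v i \<noteq> 0" using nz by blast
  have gint: "int g = Gcd (v ` {..<k})"
    by (simp add: g_def)
  have dvd: "int g dvd v j" if "j < k" for j
    using that by (simp add: gint)
  have g0: "0 < g"
    using dvd[OF i(1)] i(2) by (cases g) auto
  have gB: "g \<le> B"
    using dvd_imp_le_int[OF i(2) dvd[OF i(1)]] bd[OF i(1)] by simp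
  let ?K = "card {z \<in> {..<k} \<rightarrow>\<^sub>E carrier G. lin_comb G k z v = \<one>}"
  have "order G * ?K \<le> order G ^ k * card {x \<in> carrier G. x [^] g = \<one>}"
    using card_lin_comb_kernel[OF fin nz] by (simp add: g_def mult.commute)
  also have "\<dots> \<le> order G ^ k * g ^ min_gens G"
    using card_torsion_le_min_gens[OF fin g0] by simp
  also have "g ^ min_gens G \<le> 1 + (\<Sum>g\<in>{2..B}. g ^ min_gens G * of_bool (\<forall>i<k. int g dvd v i))"
  proof (cases "g = 1")
    case False
    then have "g \<in> {2..B}" using g0 gB by auto
    then have "g ^ min_gens G * of_bool (\<forall>i<k. int g dvd v i)
        \<le> (\<Sum>g\<in>{2..B}. g ^ min_gens G * of_bool (\<forall>i<k. int g dvd v i))"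
      by (rule member_le_sum) auto
    then show ?thesis using dvd by simp
  qed simp
  finally show ?thesis by simp
qed

text \<open>Ordered pairs with the diagonal included, so that this is the sum of the squared fibre
  sizes.\<close>

definition collisions ::
    "('a, 'b) monoid_scheme \<Rightarrow> nat \<Rightarrow> 'x set \<Rightarrow> ('x \<Rightarrow> nat \<Rightarrow> int) \<Rightarrow> (nat \<Rightarrow> 'a) \<Rightarrow> nat" where
  "collisions G k A w z = card {(x, y) \<in> A \<times> A. lin_comb G k z (w x) = lin_comb G k z (w y)}"

text \<open>Cauchy--Schwarz for the fibre sizes, whose sum is \<open>card A\<close>.\<close>

lemma card_squared_le_card_image_mult:
  assumes fin: "finite A"
  shows "card A ^ 2 \<le> card (f ` A) * card {(x, y) \<in> A \<times> A. f x = f y}"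
proof -
  define N where "N c = card {x \<in> A. f x = c}" for c
  have "card A = (\<Sum>c\<in>f ` A. N c)"
    using sum.image_gen[OF fin, of "\<lambda>_. 1::nat" f] by (simp add: N_def)
  moreover have "card {(x, y) \<in> A \<times> A. f x = f y} = (\<Sum>c\<in>f ` A. N c ^ 2)"
  proof -
    have "card {(x, y) \<in> A \<times> A. f x = f y} = card (\<Union>c\<in>f ` A. {x \<in> A. f x = c} \<times> {x \<in> A. f x = c})"
      by (rule arg_cong[where f = card]) auto
    also have "\<dots> = (\<Sum>c\<in>f ` A. card ({x \<in> A. f x = c} \<times> {x \<in> A. f x = c}))"
      by (rule card_UN_disjoint) (use fin in auto)
    finally show ?thesis by (simp add: N_def card_cartesian_product power2_eq_square)
  qed
  moreover have "(\<Sum>c\<in>f ` A. real (N c))\<^sup>2 \<le> (\<Sum>c\<in>f ` A. (real (N c))\<^sup>2) * card (f ` A)"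
    by (rule sum_squared_le_sum_of_squares)
  then have "(\<Sum>c\<in>f ` A. N c) ^ 2 \<le> (\<Sum>c\<in>f ` A. N c ^ 2) * card (f ` A)"
    by (metis (mono_tags, lifting) of_nat_le_iff of_nat_mult of_nat_power of_nat_sum sum.cong)
  ultimately show ?thesis by (simp add: mult.commute)
qed

text \<open>The three terms come from the diagonal, from the base probability 1 / |G| of each pair,
  and from the excess of pairs whose difference has a common divisor g.\<close>

lemma (in comm_group) sum_collisions_le:
  assumes fin: "finite (carrier G)" and A: "finite A"
    and inj: "\<And>x y. x \<in> A \<Longrightarrow> y \<in> A \<Longrightarrow> (\<forall>i<k. w x i = w y i) \<Longrightarrow> x = y"
    and bd: "\<And>x y i. x \<in> A \<Longrightarrow> y \<in> A \<Longrightarrow> i < k \<Longrightarrow> \<bar>w x i - w y i\<bar> \<le> int B"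
    and classes: "\<And>g x. x \<in> A \<Longrightarrow> g \<in> {2..B} \<Longrightarrow>
      real (card {y \<in> A. \<forall>i<k. int g dvd w x i - w y i}) \<le> C g"
  shows "real (order G) * (\<Sum>z\<in>{..<k} \<rightarrow>\<^sub>E carrier G. real (collisions G k A w z))
      \<le> real (order G) ^ k * (real (card A) * real (order G) + (real (card A))\<^sup>2
           + real (card A) * (\<Sum>g\<in>{2..B}. real g ^ min_gens G * C g))"
proof -
  let ?Z = "{..<k} \<rightarrow>\<^sub>E carrier G" and ?n = "order G" and ?d = "min_gens G"
  let ?K = "\<lambda>v. card {z \<in> ?Z. lin_comb G k z v = \<one>}"
  let ?D = "\<lambda>g x y. \<forall>i<k. int g dvd w x i - w y i"
  have finZ: "finite ?Z" using fin by (auto intro: finite_PiE)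
  have cZ: "card ?Z = ?n ^ k" by (simp add: card_PiE order_def)
  have n0: "0 < ?n" using fin by (auto simp: order_def card_gt_0_iff)
  have K: "?n * ?K (\<lambda>i. w x i - w y i) \<le> ?n ^ k * (?n * of_bool (x = y) + 1
      + (\<Sum>g\<in>{2..B}. g ^ ?d * of_bool (?D g x y)))" if "x \<in> A" "y \<in> A" for x y
  proof (cases "x = y")
    case True
    have "?K (\<lambda>i. w x i - w y i) \<le> ?n ^ k"
      unfolding cZ[symmetric] by (rule card_mono[OF finZ]) auto
    then have "?n * ?K (\<lambda>i. w x i - w y i) \<le> ?n ^ k * ?n"
      by (simp add: mult.commute)
    also have "\<dots> \<le> ?n ^ k * (?n * of_bool (x = y) + 1 + (\<Sum>g\<in>{2..B}. g ^ ?d * of_bool (?D g x y)))"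
      using True by (intro mult_le_mono2) simp
    finally show ?thesis .
  next
    case False
    then have "\<exists>i<k. w x i - w y i \<noteq> 0"
      using inj[OF that] by auto
    then show ?thesis
      using order_mult_card_lin_comb_kernel_le[OF fin bd[OF that], of k] False by simp
  qed
  have coll: "collisions G k A w z = (\<Sum>x\<in>A. \<Sum>y\<in>A. of_bool (lin_comb G k z (\<lambda>i. w x i - w y i) = \<one>))"
    if "z \<in> ?Z" for z
  proof -
    have "collisions G k A w z = (\<Sum>p\<in>A \<times> A. of_bool (lin_comb G k z (w (fst p)) = lin_comb G k z (w (snd p))))"
      unfolding collisions_def using sum_of_bool_eq[of "A \<times> A", where 'a = nat] A
      by (simp add: Int_def case_prod_unfold mem_Times_iff conj_assoc)
    also have "\<dots> = (\<Sum>x\<in>A. \<Sum>y\<in>A. of_bool (lin_comb G k z (w x) = lin_comb G k z (w y)))"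
      by (simp add: sum.cartesian_product case_prod_unfold)
    also have "\<dots> = (\<Sum>x\<in>A. \<Sum>y\<in>A. of_bool (lin_comb G k z (\<lambda>i. w x i - w y i) = \<one>))"
      using that lin_comb_eq_iff[of k z] by (intro sum.cong refl) (auto simp: PiE_iff)
    finally show ?thesis .
  qed
  have "(\<Sum>z\<in>?Z. collisions G k A w z) = (\<Sum>z\<in>?Z. \<Sum>x\<in>A. \<Sum>y\<in>A. of_bool (lin_comb G k z (\<lambda>i. w x i - w y i) = \<one>))"
    by (rule sum.cong[OF refl coll])
  also have "\<dots> = (\<Sum>x\<in>A. \<Sum>z\<in>?Z. \<Sum>y\<in>A. of_bool (lin_comb G k z (\<lambda>i. w x i - w y i) = \<one>))"
    by (rule sum.swap)
  also have "\<dots> = (\<Sum>x\<in>A. \<Sum>y\<in>A. \<Sum>z\<in>?Z. of_bool (lin_comb G k z (\<lambda>i. w x i - w y i) = \<one>))"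
    by (intro sum.cong refl sum.swap)
  also have "\<dots> = (\<Sum>x\<in>A. \<Sum>y\<in>A. ?K (\<lambda>i. w x i - w y i))"
    using finZ by (intro sum.cong refl) (simp add: sum_of_bool_eq Int_def)
  finally have "?n * (\<Sum>z\<in>?Z. collisions G k A w z) = (\<Sum>x\<in>A. \<Sum>y\<in>A. ?n * ?K (\<lambda>i. w x i - w y i))"
    by (simp add: sum_distrib_left)
  also have "\<dots> \<le> (\<Sum>x\<in>A. \<Sum>y\<in>A. ?n ^ k * (?n * of_bool (x = y) + 1
      + (\<Sum>g\<in>{2..B}. g ^ ?d * of_bool (?D g x y))))"
    by (intro sum_mono K)
  finally have "real (?n * (\<Sum>z\<in>?Z. collisions G k A w z)) \<le> real (\<Sum>x\<in>A. \<Sum>y\<in>A. ?n ^ k * (?n * of_bool (x = y) + 1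
      + (\<Sum>g\<in>{2..B}. g ^ ?d * of_bool (?D g x y))))"
    by (rule of_nat_mono)
  also have "\<dots> = real ?n ^ k * (\<Sum>x\<in>A. \<Sum>y\<in>A. (real ?n * of_bool (x = y) + 1
      + (\<Sum>g\<in>{2..B}. real g ^ ?d * of_bool (?D g x y))))"
    by (simp add: sum_distrib_left distrib_left add_ac)
  also have "(\<Sum>x\<in>A. \<Sum>y\<in>A. (real ?n * of_bool (x = y) + 1
      + (\<Sum>g\<in>{2..B}. real g ^ ?d * of_bool (?D g x y))))
      \<le> (\<Sum>x\<in>A. real ?n + real (card A) + (\<Sum>g\<in>{2..B}. real g ^ ?d * C g))"
  proof (rule sum_mono)
    fix x assume x: "x \<in> A"
    have "(\<Sum>y\<in>A. real ?n * of_bool (x = y)) = (\<Sum>y\<in>A. if x = y then real ?n else 0)"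
      by (rule sum.cong) auto
    also have "\<dots> = real ?n"
      using A x by simp
    finally have 1: "(\<Sum>y\<in>A. real ?n * of_bool (x = y)) = real ?n" .
    have "(\<Sum>y\<in>A. \<Sum>g\<in>{2..B}. real g ^ ?d * of_bool (?D g x y))
        = (\<Sum>g\<in>{2..B}. real g ^ ?d * (\<Sum>y\<in>A. of_bool (?D g x y)))"
      by (subst sum.swap) (simp add: sum_distrib_left)
    also have "\<dots> = (\<Sum>g\<in>{2..B}. real g ^ ?d * real (card {y \<in> A. ?D g x y}))"
      using A by (simp add: sum_of_bool_eq Int_def)
    also have "\<dots> \<le> (\<Sum>g\<in>{2..B}. real g ^ ?d * C g)"
      by (intro sum_mono mult_left_mono classes x) auto
    finally show "(\<Sum>y\<in>A. (real ?n * of_bool (x = y) + 1 + (\<Sum>g\<in>{2..B}. real g ^ ?d * of_bool (?D g x y))))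
        \<le> real ?n + real (card A) + (\<Sum>g\<in>{2..B}. real g ^ ?d * C g)"
      using 1 by (simp add: sum.distrib)
  qed
  also have "\<dots> = real (card A) * real ?n + (real (card A))\<^sup>2
           + real (card A) * (\<Sum>g\<in>{2..B}. real g ^ ?d * C g)"
    by (simp add: algebra_simps power2_eq_square)
  finally show ?thesis
    by (simp add: mult_left_mono)
qed

text \<open>Markov's inequality for the excess of \<open>collisions\<close> over its minimum \<open>(card A)\<^sup>2 / order G\<close>.\<close>

lemma (in comm_group) card_bad_generators_le:
  assumes fin: "finite (carrier G)" and A: "finite A" "A \<noteq> {}"
    and inj: "\<And>x y. x \<in> A \<Longrightarrow> y \<in> A \<Longrightarrow> (\<forall>i<k. w x i = w y i) \<Longrightarrow> x = y"
    and bd: "\<And>x y i. x \<in> A \<Longrightarrow> y \<in> A \<Longrightarrow> i < k \<Longrightarrow> \<bar>w x i - w y i\<bar> \<le> int B"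
    and classes: "\<And>g x. x \<in> A \<Longrightarrow> g \<in> {2..B} \<Longrightarrow>
      real (card {y \<in> A. \<forall>i<k. int g dvd w x i - w y i}) \<le> C g"
    and \<beta>: "0 < \<beta>" "\<beta> < 1"
  shows "real (card {z \<in> {..<k} \<rightarrow>\<^sub>E carrier G.
            real (card ((\<lambda>x. lin_comb G k z (w x)) ` A)) < \<beta> * real (order G)}) / real (order G) ^ k
     \<le> (real (order G) / real (card A)
         + (\<Sum>g\<in>{2..B}. real g ^ min_gens G * C g) / real (card A)) / (1 / \<beta> - 1)"
proof -
  let ?Z = "{..<k} \<rightarrow>\<^sub>E carrier G" and ?n = "real (order G)" and ?A = "real (card A)"
  let ?S = "\<lambda>z. (\<lambda>x. lin_comb G k z (w x)) ` A"
  let ?T = "\<lambda>z. real (collisions G k A w z)"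
  let ?E = "\<Sum>g\<in>{2..B}. real g ^ min_gens G * C g"
  define bad where "bad = {z \<in> ?Z. real (card (?S z)) < \<beta> * ?n}"
  have n0: "0 < ?n" using fin by (auto simp: order_def card_gt_0_iff)
  have A0: "0 < ?A" using A by (simp add: card_gt_0_iff)
  have finZ: "finite ?Z" using fin by (auto intro: finite_PiE)
  have cZ: "real (card ?Z) = ?n ^ k" by (simp add: card_PiE order_def)
  have CS: "?A\<^sup>2 \<le> real (card (?S z)) * ?T z" for z
  proof -
    have "card A ^ 2 \<le> card (?S z) * collisions G k A w z"
      unfolding collisions_def by (rule card_squared_le_card_image_mult[OF A(1)])
    then have "real (card A ^ 2) \<le> real (card (?S z) * collisions G k A w z)"
      by (rule of_nat_mono)
    then show ?thesis by simp
  qed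
  \<comment> \<open>Nonnegativity of the excess allows the sum over bad tuples to be enlarged to all
    tuples.\<close>
  have T0: "0 \<le> ?T z - ?A\<^sup>2 / ?n" if "z \<in> ?Z" for z
  proof -
    have "?S z \<subseteq> carrier G"
      using that by (auto simp: PiE_iff intro!: lin_comb_closed)
    then have "card (?S z) \<le> order G"
      unfolding order_def using fin by (intro card_mono)
    then have "real (card (?S z)) * ?T z \<le> ?n * ?T z"
      by (intro mult_right_mono) auto
    then have "?A\<^sup>2 \<le> ?n * ?T z"
      using CS[of z] by linarith
    then show ?thesis
      using n0 by (simp add: field_simps)
  qed
  \<comment> \<open>An image smaller than beta |G| forces at least 1 / beta times the minimal number
    of collisions.\<close>
  have bad: "(1 / \<beta> - 1) * (?A\<^sup>2 / ?n) \<le> ?T z - ?A\<^sup>2 / ?n" if "z \<in> bad" for z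
  proof -
    have "real (card (?S z)) * ?T z \<le> \<beta> * ?n * ?T z"
      using that by (intro mult_right_mono) (auto simp: bad_def)
    then have "?A\<^sup>2 \<le> \<beta> * ?n * ?T z"
      using CS[of z] by linarith
    then show ?thesis
      using n0 \<beta> by (simp add: field_simps)
  qed
  have "real (card bad) * ((1 / \<beta> - 1) * (?A\<^sup>2 / ?n)) = (\<Sum>z\<in>bad. (1 / \<beta> - 1) * (?A\<^sup>2 / ?n))"
    by simp
  also have "\<dots> \<le> (\<Sum>z\<in>bad. ?T z - ?A\<^sup>2 / ?n)"
    by (intro sum_mono bad)
  also have "\<dots> \<le> (\<Sum>z\<in>?Z. ?T z - ?A\<^sup>2 / ?n)"
    by (rule sum_mono2[OF finZ]) (use T0 in \<open>auto simp: bad_def\<close>)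
  also have "\<dots> = (\<Sum>z\<in>?Z. ?T z) - ?n ^ k * (?A\<^sup>2 / ?n)"
    by (simp add: sum_subtractf cZ)
  also have "\<dots> \<le> ?n ^ k * (?A * ?n + ?A\<^sup>2 + ?A * ?E) / ?n - ?n ^ k * (?A\<^sup>2 / ?n)"
  proof (rule diff_right_mono)
    have "?n * (\<Sum>z\<in>?Z. ?T z) \<le> ?n ^ k * (?A * ?n + ?A\<^sup>2 + ?A * ?E)"
      by (rule sum_collisions_le[OF fin A(1) inj bd classes])
    then show "(\<Sum>z\<in>?Z. ?T z) \<le> ?n ^ k * (?A * ?n + ?A\<^sup>2 + ?A * ?E) / ?n"
      using n0 by (subst pos_le_divide_eq) (auto simp: mult.commute)
  qed
  \<comment> \<open>The leading term cancels the minimum exactly; only the diagonal and the common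
    divisors remain.\<close>
  also have "\<dots> = ?n ^ k * (?A * ?n + ?A * ?E) / ?n"
    using n0 by (simp add: field_simps)
  also have "\<dots> = ?n ^ k * (?n / ?A + ?E / ?A) * (?A\<^sup>2 / ?n)"
    using n0 A0 by (simp add: power2_eq_square divide_simps) (simp add: algebra_simps)
  finally have "real (card bad) * (1 / \<beta> - 1) * (?A\<^sup>2 / ?n) \<le> ?n ^ k * (?n / ?A + ?E / ?A) * (?A\<^sup>2 / ?n)"
    by (simp only: mult.assoc)
  moreover have "0 < ?A\<^sup>2 / ?n"
    using n0 A0 by simp
  ultimately have "real (card bad) * (1 / \<beta> - 1) \<le> ?n ^ k * (?n / ?A + ?E / ?A)"
    by (rule mult_right_le_imp_le)
  then have "real (card bad) / ?n ^ k * (1 / \<beta> - 1) \<le> ?n / ?A + ?E / ?A"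
    using n0 by (simp add: field_simps)
  then show ?thesis
    unfolding bad_def[symmetric] using \<beta> by (subst pos_le_divide_eq) auto
qed

section \<open>Paths and coefficient vectors\<close>

text \<open>This is the ratio of C for the given orientation to C in the directed case. Signed
  coefficients become lists of naturals at a radius larger by this factor, so the count in the
  positive orthant serves both orientations.\<close>

fun sign_count :: "orientation \<Rightarrow> nat" where
  "sign_count Directed = 1"
| "sign_count Undirected = 2"

text \<open>Coefficients are enumerated by naturals, in the undirected case as \<open>0, -1, 1, -2, 2, \<dots>\<close>; the
  \<open>u\<close>-th one has size about \<open>u / sign_count s\<close>.\<close>

fun coefficient :: "orientation \<Rightarrow> nat \<Rightarrow> int" where
  "coefficient Directed u = int u"
| "coefficient Undirected u = (if even u then int (u div 2) else - int (u div 2) - 1)"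

lemma sign_count_pos [simp]: "0 < sign_count s"
  by (cases s) auto

lemma C_const_eq: "C_const s q = real (sign_count s) * C_const Directed q"
  by (cases s) auto

lemma coefficient_eq_iff [simp]: "coefficient s u = coefficient s v \<longleftrightarrow> u = v"
  by (cases s) (auto elim!: evenE oddE split: if_splits; presburger)+

lemma abs_coefficient_bounds:
  "int u \<le> int (sign_count s) * \<bar>coefficient s u\<bar>"
  "int (sign_count s) * \<bar>coefficient s u\<bar> \<le> int u + 1"
  "\<bar>coefficient s u\<bar> \<le> int u"
  by (cases s; force elim!: evenE oddE split: if_splits)+

lemma ex_coefficient:
  assumes "s = Directed \<Longrightarrow> 0 \<le> x"
  shows "\<exists>u. coefficient s u = x"
proof (cases s)
  case Directed
  then show ?thesis using assms by (intro exI[of _ "nat x"]) auto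
next
  case Undirected
  show ?thesis
  proof (cases "0 \<le> x")
    case True
    then show ?thesis using Undirected by (intro exI[of _ "2 * nat x"]) auto
  next
    case False
    then show ?thesis using Undirected by (intro exI[of _ "2 * nat (- x - 1) + 1"]) auto
  qed
qed

text \<open>Equal remainders modulo \<open>sign_count s\<close> give equal signs. The magnitudes are
  then congruent modulo g, and having the same quotient by g they agree.\<close>

lemma coefficient_cong_imp_eq:
  assumes "0 < g" "int g dvd coefficient s u - coefficient s v"
    and "u mod sign_count s = v mod sign_count s"
    and "u div (sign_count s * g) = v div (sign_count s * g)"
  shows "u = v"
proof -
  have *: "a = b" if "int g dvd int a - int b" "a div g = b div g" for a b
  proof -
    have "a mod g = b mod g"
      using that(1) by (metis mod_eq_dvd_iff of_nat_eq_iff of_nat_mod)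
    then show ?thesis
      using that(2) by (metis div_mult_mod_eq)
  qed
  show ?thesis
  proof (cases s)
    case Directed
    then show ?thesis using assms * by simp
  next
    case Undirected
    let ?a = "u div 2" and ?b = "v div 2"
    have div: "?a div g = ?b div g"
      using assms(4) Undirected by (simp add: div_mult2_eq)
    have parity: "even u \<longleftrightarrow> even v"
      using assms(3) Undirected by (simp add: even_iff_mod_2_eq_zero)
    have "int g dvd int ?a - int ?b"
      using assms(2) Undirected parity
      by (cases "even u") (auto simp: dvd_diff_commute)
    then have "?a = ?b" using div * by blast
    then show ?thesis
      using assms(3) Undirected by (metis div_mult_mod_eq sign_count.simps(2))
  qed
qed

definition net_count :: "(nat \<times> sign) list \<Rightarrow> nat \<Rightarrow> int" where
  "net_count \<rho> i = int (count_list \<rho> (i, Pos)) - int (count_list \<rho> (i, Neg))"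

context comm_group
begin

lemma lin_comb_indicator:
  assumes "\<And>i. i < k \<Longrightarrow> z i \<in> carrier G" "i < k"
  shows "lin_comb G k z (\<lambda>j. if j = i then a else 0) = z i [^] a"
proof -
  have "lin_comb G k z (\<lambda>j. if j = i then a else 0) = (\<Otimes>j\<in>{..<k}. if i = j then z j [^] a else \<one>)"
    unfolding lin_comb_def by (rule finprod_cong') (use assms in auto)
  also have "\<dots> = z i [^] a"
    using assms by (intro finprod_singleton) auto
  finally show ?thesis .
qed

lemma lin_comb_zero: "(\<And>i. i < k \<Longrightarrow> z i \<in> carrier G) \<Longrightarrow> lin_comb G k z (\<lambda>_. 0) = \<one>"
  unfolding lin_comb_def by (simp add: finprod_one_eqI)

lemma cayley_path_iff:
  assumes z: "\<And>i. i < k \<Longrightarrow> z i \<in> carrier G"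
  shows "cayley_path s G k z x \<rho> y \<longleftrightarrow> x \<in> carrier G \<and>
     (\<forall>(i, \<sigma>)\<in>set \<rho>. i < k \<and> (\<sigma> = Neg \<longrightarrow> s = Undirected)) \<and> y = x \<otimes> lin_comb G k z (net_count \<rho>)"
proof (induction \<rho> arbitrary: x)
  case Nil
  have "cayley_path s G k z x [] y \<longleftrightarrow> x \<in> carrier G \<and> y = x"
    by (auto elim: cayley_path.cases intro: cayley_path.nil)
  moreover have "net_count [] = (\<lambda>_. 0)"
    by (auto simp: net_count_def)
  ultimately show ?case
    using lin_comb_zero[OF z] by auto
next
  case (Cons step \<rho>)
  obtain i \<sigma> where step: "step = (i, \<sigma>)" by fastforce
  define a :: int where "a = (if \<sigma> = Pos then 1 else -1)"
  have "cayley_path s G k z x ((i, \<sigma>) # \<rho>) y \<longleftrightarrow> x \<in> carrier G \<and> i < k \<and> (\<sigma> = Neg \<longrightarrow> s = Undirected)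
      \<and> cayley_path s G k z (x \<otimes> z i [^] a) \<rho> y"
    using z by (cases \<sigma>) (auto simp: a_def int_pow_neg elim: cayley_path.cases intro: cayley_path.intros)
  moreover have "x \<otimes> z i [^] a \<otimes> lin_comb G k z (net_count \<rho>) = x \<otimes> lin_comb G k z (net_count (step # \<rho>))"
    if "x \<in> carrier G" "i < k"
  proof -
    have "net_count (step # \<rho>) = (\<lambda>j. (if j = i then a else 0) + net_count \<rho> j)"
      by (cases \<sigma>) (auto simp: fun_eq_iff net_count_def step a_def)
    then have "lin_comb G k z (net_count (step # \<rho>)) = z i [^] a \<otimes> lin_comb G k z (net_count \<rho>)"
      using lin_comb_add[OF z] lin_comb_indicator[OF z that(2)] by simp
    then show ?thesis
      using that z lin_comb_closed[OF z] by (simp add: m_assoc)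
  qed
  ultimately show ?case
    using Cons.IH[of "x \<otimes> z i [^] a"] z by (auto simp: step)
qed

end

section \<open>From short paths to lattice points and back\<close>

text \<open>After scaling to x + y = 1 this is t^p <= t on the unit interval.\<close>

lemma powr_add_le_add_powr:
  fixes x y p :: real
  assumes "0 \<le> x" "0 \<le> y" "1 \<le> p"
  shows "x powr p + y powr p \<le> (x + y) powr p"
proof (cases "x + y = 0")
  case False
  then have pos: "0 < x + y" using assms by simp
  have *: "t powr p \<le> t" if "0 \<le> t" "t \<le> 1" for t :: real
    using powr_mono'[of 1 p t] that assms by (cases "t = 0") auto
  have "(x powr p + y powr p) / (x + y) powr p = (x / (x + y)) powr p + (y / (x + y)) powr p"
    using assms pos by (simp add: powr_divide add_divide_distrib)
  also have "\<dots> \<le> x / (x + y) + y / (x + y)"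
    using assms pos by (intro add_mono *) auto
  also have "\<dots> = 1"
    using pos by (simp flip: add_divide_distrib)
  finally show ?thesis
    using pos by (simp add: divide_le_eq)
qed (use assms in \<open>auto simp: add_nonneg_eq_0_iff\<close>)

text \<open>It absorbs the rounding error 1 of \<open>abs_coefficient_bounds\<close>: for u >= 1/eta
  it fits into the factor 1 + eta, and below that u + 1 is bounded by a constant.\<close>

lemma plus1_powr_le:
  fixes u \<eta> p :: real
  assumes "0 \<le> u" "0 < \<eta>" "1 \<le> p"
  shows "(u + 1) powr p \<le> ((1 + \<eta>) * u) powr p + (1 + 1 / \<eta>) powr p"
proof (cases "1 / \<eta> \<le> u")
  case True
  then have "u + 1 \<le> (1 + \<eta>) * u"
    using assms by (simp add: field_simps)
  then have "(u + 1) powr p \<le> ((1 + \<eta>) * u) powr p"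
    using assms by (intro powr_mono2) auto
  then show ?thesis by (simp add: add_increasing2)
next
  case False
  then have "(u + 1) powr p \<le> (1 + 1 / \<eta>) powr p"
    using assms by (intro powr_mono2) auto
  then show ?thesis by (simp add: add_increasing)
qed

lemma sum_list_powr_conv: "powr_sum p xs = (\<Sum>i<length xs. real (xs ! i) powr p)"
  unfolding powr_sum_def by (simp add: sum_list_sum_nth atLeast0LessThan)

lemma exists_list_nth_eq:
  assumes "\<And>i. i < k \<Longrightarrow> \<exists>u. P i u"
  obtains xs where "length xs = k" "\<And>i. i < k \<Longrightarrow> P i (xs ! i)"
proof -
  obtain f where "\<And>i. i < k \<Longrightarrow> P i (f i)" using assms by metis
  then show thesis using that[of "map f [0..<k]"] by simp
qed

text \<open>The strict bound on R yields an actual path, of length below the bound, from the infimum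
  in \<open>Lq_dist\<close>.\<close>

lemma (in comm_group) Lq_ball_subset_image_qball:
  assumes q: "1 \<le> q" and k: "0 < k" and z: "\<And>i. i < k \<Longrightarrow> z i \<in> carrier G"
    and r: "0 < r" and R: "R < real k powr root_exp q * r / real (sign_count s)"
  shows "Lq_ball s q G k z R \<subseteq> (\<lambda>xs. lin_comb G k z (\<lambda>i. coefficient s (xs ! i))) ` qball q k r"
proof
  let ?c = "real (sign_count s)"
  let ?R = "real k powr root_exp q * r / ?c"
  fix x assume "x \<in> Lq_ball s q G k z R"
  then have "Lq_dist s q G k z x < ereal ?R"
    using R by (auto simp: Lq_ball_def intro: le_less_trans)
  then obtain \<rho> where path: "cayley_path s G k z \<one> \<rho> x" and len: "Lq_length q k \<rho> < ?R"
    by (auto simp: Lq_dist_def Inf_less_iff)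
  have steps: "\<And>i. s = Directed \<Longrightarrow> (i, Neg) \<notin> set \<rho>" and x: "x = lin_comb G k z (net_count \<rho>)"
    using path z lin_comb_closed[OF z] by (auto simp: cayley_path_iff[OF z])
  have "\<exists>u. coefficient s u = net_count \<rho> i" for i
    using steps[of i] by (intro ex_coefficient) (simp add: net_count_def count_notin)
  then obtain xs where xs: "length xs = k" "\<And>i. i < k \<Longrightarrow> coefficient s (xs ! i) = net_count \<rho> i"
    using exists_list_nth_eq[of k "\<lambda>i u. coefficient s u = net_count \<rho> i"] by blast
  have x_eq: "x = lin_comb G k z (\<lambda>i. coefficient s (xs ! i))"
    unfolding x by (rule lin_comb_cong[symmetric]) (use z xs in auto)
  have le: "real (xs ! i) \<le> ?c * real_of_int \<bar>net_count \<rho> i\<bar>" if "i < k" for i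
    using abs_coefficient_bounds(1)[of "xs ! i" s] xs(2)[OF that]
    by (metis of_int_le_iff of_int_mult of_int_of_nat_eq)
  have "xs \<in> qball q k r"
  proof (cases q)
    case (real p)
    then have p: "1 \<le> p" using q by simp
    let ?N = "\<lambda>i. real (count_list \<rho> (i, Pos)) powr p + real (count_list \<rho> (i, Neg)) powr p"
    have "(\<Sum>i<k. ?N i) powr (1 / p) < ?R"
      using len p real by (simp add: Lq_length_def root_exp_ereal)
    then have "((\<Sum>i<k. ?N i) powr (1 / p)) powr p \<le> ?R powr p"
      using p by (intro powr_mono2) auto
    then have "(\<Sum>i<k. ?N i) \<le> ?R powr p"
      using p by (simp add: powr_powr sum_nonneg)
    moreover have "?R powr p = real k * (r / ?c) powr p"
      using p r real by (simp add: root_exp_ereal powr_mult powr_divide powr_powr)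
    ultimately have N: "(\<Sum>i<k. ?N i) \<le> real k * (r / ?c) powr p" by simp
    have "powr_sum p xs = (\<Sum>i<k. real (xs ! i) powr p)"
      using xs by (simp add: sum_list_powr_conv)
    also have "\<dots> \<le> (\<Sum>i<k. ?c powr p * ?N i)"
    proof (rule sum_mono)
      fix i assume i: "i \<in> {..<k}"
      have "real (xs ! i) powr p \<le> (?c * real_of_int \<bar>net_count \<rho> i\<bar>) powr p"
        using le[of i] i p by (intro powr_mono2) auto
      also have "\<dots> = ?c powr p * real_of_int \<bar>net_count \<rho> i\<bar> powr p"
        by (simp add: powr_mult)
      \<comment> \<open>The net count is at most the larger of the two counts, whose p-th power is
        one of the terms of \<open>?N i\<close>.\<close>
      also have "real_of_int \<bar>net_count \<rho> i\<bar> powr p \<le> ?N i"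
      proof (cases "count_list \<rho> (i, Neg) \<le> count_list \<rho> (i, Pos)")
        case True
        then have "real_of_int \<bar>net_count \<rho> i\<bar> powr p \<le> real (count_list \<rho> (i, Pos)) powr p"
          using p by (intro powr_mono2) (auto simp: net_count_def)
        then show ?thesis by (simp add: add_increasing2)
      next
        case False
        then have "real_of_int \<bar>net_count \<rho> i\<bar> powr p \<le> real (count_list \<rho> (i, Neg)) powr p"
          using p by (intro powr_mono2) (auto simp: net_count_def)
        then show ?thesis by (simp add: add_increasing)
      qed
      finally show "real (xs ! i) powr p \<le> ?c powr p * ?N i"
        by (simp add: mult_left_mono)
    qed
    also have "\<dots> \<le> ?c powr p * (real k * (r / ?c) powr p)"
      using N by (simp flip: sum_distrib_left)
    also have "\<dots> = real k * r powr p"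
      using r by (simp add: powr_divide)
    finally show ?thesis
      using xs real by (simp add: qball_def powr_sum_lists_def)
  next
    case PInf
    have "real (xs ! i) \<le> r" if i: "i < k" for i
    proof -
      let ?m = "\<lambda>i. count_list \<rho> (i, Pos) + count_list \<rho> (i, Neg)"
      have "?m i \<le> Max (?m ` {..<k})"
        using i by (intro Max_ge) auto
      moreover have "real (Max (?m ` {..<k})) < r / ?c"
        using len PInf k by (simp add: Lq_length_def)
      ultimately have "real (?m i) \<le> r / ?c"
        by linarith
      moreover have "real_of_int \<bar>net_count \<rho> i\<bar> \<le> real (?m i)"
        by (simp add: net_count_def)
      ultimately have "real_of_int \<bar>net_count \<rho> i\<bar> \<le> r / ?c" by linarith
      then have "?c * real_of_int \<bar>net_count \<rho> i\<bar> \<le> r"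
        by (simp add: field_simps)
      then show ?thesis using le[OF i] by linarith
    qed
    then show ?thesis
      using xs PInf by (auto simp: qball_def in_set_conv_nth)
  qed (use q in auto)
  then show "x \<in> (\<lambda>xs. lin_comb G k z (\<lambda>i. coefficient s (xs ! i))) ` qball q k r"
    using x_eq by blast
qed

text \<open>Each generator is used with one sign only, so its count is |v_i| and no length is lost
  to cancellation.\<close>

definition straight_path :: "nat \<Rightarrow> (nat \<Rightarrow> int) \<Rightarrow> (nat \<times> sign) list" where
  "straight_path k v = concat (map (\<lambda>i. replicate (nat \<bar>v i\<bar>) (i, if 0 \<le> v i then Pos else Neg)) [0..<k])"

lemma count_list_replicate: "count_list (replicate n x) y = (if x = y then n else 0)"
  by (induction n) auto

lemma count_list_straight_path:
  "count_list (straight_path k v) (i, Pos) = (if i < k then nat (v i) else 0)"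
  "count_list (straight_path k v) (i, Neg) = (if i < k then nat (- v i) else 0)"
  by (induction k) (auto simp: straight_path_def count_list_replicate less_Suc_eq)

text \<open>A converse to \<open>Lq_ball_subset_image_qball\<close> up to rounding. The entry x
  stands for a coefficient of size at most (x + 1) / sign_count; \<open>plus1_powr_le\<close> splits
  the extra 1 into a factor 1 + eta and an additive constant.\<close>

lemma (in comm_group) lin_comb_mem_Lq_ball:
  assumes q: "1 \<le> q" and k: "0 < k" and z: "\<And>i. i < k \<Longrightarrow> z i \<in> carrier G"
    and r: "0 < r" and \<eta>: "0 < \<eta>" and xs: "xs \<in> qball q k r"
    and R: "real k powr root_exp q * ((1 + \<eta>) * r + (1 + 1 / \<eta>)) / real (sign_count s) \<le> R"
  shows "lin_comb G k z (\<lambda>i. coefficient s (xs ! i)) \<in> Lq_ball s q G k z R"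
proof -
  let ?c = "real (sign_count s)" and ?v = "\<lambda>i. coefficient s (xs ! i)"
  let ?\<rho> = "straight_path k ?v" and ?b = "(1 + \<eta>) * r + (1 + 1 / \<eta>)"
  have len: "length xs = k"
    using xs by (auto simp: qball_def powr_sum_lists_def split: if_splits)
  have net: "net_count ?\<rho> i = ?v i" if "i < k" for i
    using that by (simp add: net_count_def count_list_straight_path)
  have "lin_comb G k z (net_count ?\<rho>) = lin_comb G k z ?v"
    by (rule lin_comb_cong) (use z net in auto)
  moreover have "i < k \<and> (\<sigma> = Neg \<longrightarrow> s = Undirected)" if "(i, \<sigma>) \<in> set ?\<rho>" for i \<sigma>
  proof
    show "i < k" using that by (auto simp: straight_path_def)
    show "\<sigma> = Neg \<longrightarrow> s = Undirected"
      using that by (cases s) (auto simp: straight_path_def)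
  qed
  ultimately have path: "cayley_path s G k z \<one> ?\<rho> (lin_comb G k z ?v)"
    using lin_comb_closed[OF z] by (auto simp: cayley_path_iff[OF z])
  have le: "real_of_int \<bar>?v i\<bar> \<le> (real (xs ! i) + 1) / ?c" for i
  proof -
    have "real_of_int (int (sign_count s) * \<bar>?v i\<bar>) \<le> real_of_int (int (xs ! i) + 1)"
      using abs_coefficient_bounds(2)[of s "xs ! i"] by (simp only: of_int_le_iff)
    then show ?thesis by (simp add: field_simps)
  qed
  have b0: "0 \<le> ?b" using r \<eta> by simp
  have "Lq_length q k ?\<rho> \<le> real k powr root_exp q * ?b / ?c"
  proof (cases q)
    case (real p)
    then have p: "1 \<le> p" using q by simp
    have "(\<Sum>i<k. real (count_list ?\<rho> (i, Pos)) powr p + real (count_list ?\<rho> (i, Neg)) powr p)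
        \<le> (\<Sum>i<k. (((1 + \<eta>) * real (xs ! i)) powr p + (1 + 1 / \<eta>) powr p) / ?c powr p)"
    proof (rule sum_mono)
      fix i assume "i \<in> {..<k}"
      then have "real (count_list ?\<rho> (i, Pos)) powr p + real (count_list ?\<rho> (i, Neg)) powr p
          = real_of_int \<bar>?v i\<bar> powr p"
        by (cases "0 \<le> ?v i") (auto simp: count_list_straight_path)
      also have "\<dots> \<le> ((real (xs ! i) + 1) / ?c) powr p"
        using p le by (intro powr_mono2) auto
      also have "\<dots> = (real (xs ! i) + 1) powr p / ?c powr p"
        by (simp add: powr_divide)
      also have "\<dots> \<le> (((1 + \<eta>) * real (xs ! i)) powr p + (1 + 1 / \<eta>) powr p) / ?c powr p"
        using plus1_powr_le[of "real (xs ! i)" \<eta> p] p \<eta> by (intro divide_right_mono) auto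
      finally show "real (count_list ?\<rho> (i, Pos)) powr p + real (count_list ?\<rho> (i, Neg)) powr p
          \<le> (((1 + \<eta>) * real (xs ! i)) powr p + (1 + 1 / \<eta>) powr p) / ?c powr p" .
    qed
    also have "\<dots> = ((1 + \<eta>) powr p * powr_sum p xs + real k * (1 + 1 / \<eta>) powr p) / ?c powr p"
      using \<eta> by (simp add: sum_list_powr_conv len powr_mult sum.distrib flip: sum_divide_distrib sum_distrib_left)
    also have "\<dots> \<le> ((1 + \<eta>) powr p * (real k * r powr p) + real k * (1 + 1 / \<eta>) powr p) / ?c powr p"
      using xs real by (intro divide_right_mono add_right_mono mult_left_mono)
        (auto simp: qball_def powr_sum_lists_def)
    also have "\<dots> = real k * (((1 + \<eta>) * r) powr p + (1 + 1 / \<eta>) powr p) / ?c powr p"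
    proof -
      have "((1 + \<eta>) * r) powr p = (1 + \<eta>) powr p * r powr p"
        using \<eta> r by (simp add: powr_mult)
      then show ?thesis by (simp add: distrib_left mult_ac)
    qed
    \<comment> \<open>Superadditivity of the p-th power merges both terms into one radius.\<close>
    also have "\<dots> \<le> real k * ?b powr p / ?c powr p"
      using \<eta> r p by (intro divide_right_mono mult_left_mono powr_add_le_add_powr) auto
    finally have "(\<Sum>i<k. real (count_list ?\<rho> (i, Pos)) powr p + real (count_list ?\<rho> (i, Neg)) powr p) powr (1 / p)
        \<le> (real k * ?b powr p / ?c powr p) powr (1 / p)"
      using p by (intro powr_mono2) (auto intro!: sum_nonneg)
    also have "\<dots> = real k powr (1 / p) * ?b / ?c"
      using p b0 by (simp add: powr_divide powr_mult powr_powr)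
    finally show ?thesis
      using p real by (simp add: Lq_length_def root_exp_ereal)
  next
    case PInf
    have "real (count_list ?\<rho> (i, Pos) + count_list ?\<rho> (i, Neg)) \<le> ?b / ?c" if i: "i < k" for i
    proof -
      have "real (xs ! i) \<le> r"
        using xs PInf i len by (auto simp: qball_def)
      then have "real (xs ! i) + 1 \<le> ?b"
        using r \<eta> by (simp add: distrib_right add_mono add_increasing2)
      then have "(real (xs ! i) + 1) / ?c \<le> ?b / ?c"
        by (intro divide_right_mono) auto
      then have "real_of_int \<bar>?v i\<bar> \<le> ?b / ?c"
        using le[of i] by linarith
      then show ?thesis
        using i by (auto simp: count_list_straight_path)
    qed
    moreover have "Max ((\<lambda>i. count_list ?\<rho> (i, Pos) + count_list ?\<rho> (i, Neg)) ` {..<k})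
        \<in> (\<lambda>i. count_list ?\<rho> (i, Pos) + count_list ?\<rho> (i, Neg)) ` {..<k}"
      using k by (intro Max_in) auto
    ultimately have "real (Max ((\<lambda>i. count_list ?\<rho> (i, Pos) + count_list ?\<rho> (i, Neg)) ` {..<k})) \<le> ?b / ?c"
      by auto
    then show ?thesis
      using PInf k by (simp add: Lq_length_def)
  qed (use q in auto)
  also have "\<dots> \<le> R" by (rule R)
  finally have "Lq_length q k ?\<rho> \<le> R" .
  have "Lq_dist s q G k z (lin_comb G k z ?v) \<le> ereal (Lq_length q k ?\<rho>)"
    unfolding Lq_dist_def using path by (intro Inf_lower) auto
  also have "\<dots> \<le> ereal R"
    using \<open>Lq_length q k ?\<rho> \<le> R\<close> by simp
  finally show ?thesis
    using lin_comb_closed[OF z] by (simp add: Lq_ball_def)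
qed

text \<open>Division by \<open>sign_count s * g\<close> maps a residue class modulo \<open>g\<close> to a smaller ball; the
  remainders modulo \<open>sign_count s\<close> make this map injective.\<close>

lemma card_qball_residue_class_le:
  assumes q: "1 \<le> q" and r: "0 < r" and g: "0 < g"
  shows "real (card {ys \<in> qball q k r. \<forall>i<k. int g dvd a i - coefficient s (ys ! i)})
    \<le> (real (sign_count s) * exp (root_exp q) + C_const Directed q * r / real g) ^ k"
proof -
  let ?c = "sign_count s"
  let ?r = "r / (real ?c * real g)"
  let ?A = "{ys \<in> qball q k r. \<forall>i<k. int g dvd a i - coefficient s (ys ! i)}"
  let ?f = "\<lambda>ys. (map (\<lambda>u. u div (?c * g)) ys, map (\<lambda>u. u mod ?c) ys)"
  let ?M = "{ts. set ts \<subseteq> {..<?c} \<and> length ts = k}"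
  have len: "length ys = k" if "ys \<in> qball q k r" for ys
    using that by (auto simp: qball_def powr_sum_lists_def split: if_splits)
  have div_le: "real (u div (?c * g)) \<le> real u / (real ?c * real g)" for u
    unfolding of_nat_mult[symmetric]
    using of_int_floor_le[of "real u / real (?c * g)"] unfolding floor_divide_of_nat_eq by simp
  have fin: "finite (qball q k ?r \<times> ?M)"
    by (intro finite_cartesian_product finite_qball[OF q] finite_lists_length_eq) simp
  have "card ?A \<le> card (qball q k ?r \<times> ?M)"
  proof (rule card_inj_on_le[OF _ _ fin])
    show "inj_on ?f ?A"
    proof (rule inj_onI)
      fix xs ys assume xs: "xs \<in> ?A" and ys: "ys \<in> ?A" and eq: "?f xs = ?f ys"
      show "xs = ys"
      proof (rule nth_equalityI)
        show "length xs = length ys" using xs ys len by simp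
        fix i assume "i < length xs"
        then have i: "i < k" "i < length xs" "i < length ys" using xs ys len by auto
        show "xs ! i = ys ! i"
        proof (rule coefficient_cong_imp_eq[OF g])
          have "int g dvd (a i - coefficient s (ys ! i)) - (a i - coefficient s (xs ! i))"
            by (rule dvd_diff) (use xs ys i in auto)
          then show "int g dvd coefficient s (xs ! i) - coefficient s (ys ! i)"
            by simp
          show "xs ! i mod ?c = ys ! i mod ?c"
            using eq i by (metis (no_types, lifting) nth_map prod.inject)
          show "xs ! i div (?c * g) = ys ! i div (?c * g)"
            using eq i by (metis (no_types, lifting) nth_map prod.inject)
        qed
      qed
    qed
    show "?f ` ?A \<subseteq> qball q k ?r \<times> ?M"
    proof (rule image_subsetI)
      fix ys assume "ys \<in> ?A"
      then have ys: "ys \<in> qball q k r" by simp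
      have "map (\<lambda>u. u div (?c * g)) ys \<in> qball q k ?r"
      proof (cases q)
        case (real p)
        then have p: "1 \<le> p" using q by simp
        have "powr_sum p (map (\<lambda>u. u div (?c * g)) ys) \<le> powr_sum p ys / (real ?c * real g) powr p"
        proof (induction ys)
          case (Cons u us)
          have "real (u div (?c * g)) powr p \<le> (real u / (real ?c * real g)) powr p"
            using p div_le by (intro powr_mono2) auto
          also have "\<dots> = real u powr p / (real ?c * real g) powr p"
            by (simp add: powr_divide)
          finally show ?case
            using Cons by (simp add: add_divide_distrib)
        qed simp
        also have "\<dots> \<le> real k * r powr p / (real ?c * real g) powr p"
          using ys real by (intro divide_right_mono) (auto simp: qball_def powr_sum_lists_def)
        also have "\<dots> = real k * ?r powr p"
          using r by (simp add: powr_divide)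
        finally show ?thesis
          using ys real by (simp add: qball_def powr_sum_lists_def)
      next
        case PInf
        have "real (u div (?c * g)) \<le> ?r" if "u \<in> set ys" for u
        proof -
          have "real u / (real ?c * real g) \<le> ?r"
            using that ys PInf by (intro divide_right_mono) (auto simp: qball_def)
          then show ?thesis using div_le[of u] by linarith
        qed
        then show ?thesis
          using ys PInf by (auto simp: qball_def)
      qed (use q in auto)
      then show "?f ys \<in> qball q k ?r \<times> ?M"
        using len[OF ys] by auto
    qed
  qed
  also have "\<dots> = card (qball q k ?r) * ?c ^ k"
    by (simp add: card_cartesian_product card_lists_length_eq)
  finally have "card ?A \<le> card (qball q k ?r) * ?c ^ k" .
  then have "real (card ?A) \<le> real (card (qball q k ?r) * ?c ^ k)"
    by (rule of_nat_mono)
  then have "real (card ?A) \<le> real (card (qball q k ?r)) * real ?c ^ k"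
    by simp
  also have "\<dots> \<le> (exp (root_exp q) + C_const Directed q * ?r) ^ k * real ?c ^ k"
    using r g by (intro mult_right_mono card_qball_le[OF q]) auto
  also have "\<dots> = ((exp (root_exp q) + C_const Directed q * ?r) * real ?c) ^ k"
    by (simp only: power_mult_distrib)
  \<comment> \<open>The \<open>sign_count s\<close> remainders per coordinate cancel the same factor
    in \<open>?r\<close>; the price is that factor in front of the additive term.\<close>
  also have "(exp (root_exp q) + C_const Directed q * ?r) * real ?c
      = real ?c * exp (root_exp q) + C_const Directed q * r / real g"
  proof -
    have "real ?c \<noteq> 0" by (cases s) auto
    then show ?thesis
      using g by (simp add: field_simps del: C_const.simps)
  qed
  finally show ?thesis .
qed

section \<open>Typical distances\<close>

text \<open>An arbitrary condition on the tuple is a finite disjoint union of events that fix all k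
  values, each of probability |G|^-k. So it is measurable and its probability is a count. The tuple
  is restricted to \<open>{..<k}\<close> to lie in the extensional product.\<close>

lemma iid_uniform_measure:
  assumes iid: "iid_uniform M G k Z" and fin: "finite (carrier G)" and k: "0 < k"
  shows "{\<omega> \<in> space M. P (\<lambda>i\<in>{..<k}. Z i \<omega>)} \<in> sets M" (is "?E \<in> _")
    and "measure M {\<omega> \<in> space M. P (\<lambda>i\<in>{..<k}. Z i \<omega>)}
      = real (card {z \<in> {..<k} \<rightarrow>\<^sub>E carrier G. P z}) / real (order G) ^ k"
    and "\<And>\<omega> i. \<omega> \<in> space M \<Longrightarrow> i < k \<Longrightarrow> Z i \<omega> \<in> carrier G"
proof -
  interpret prob_space M
    using iid by (simp add: iid_uniform_def)
  have indep: "indep_vars (\<lambda>_. count_space (carrier G)) Z {..<k}"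
    using iid by (simp add: iid_uniform_def)
  have meas: "Z i \<in> measurable M (count_space (carrier G))" if "i < k" for i
    using indep that by (auto simp: indep_vars_def)
  show car: "Z i \<omega> \<in> carrier G" if "\<omega> \<in> space M" "i < k" for \<omega> i
    using measurable_space[OF meas[OF that(2)] that(1)] by simp
  let ?F = "\<lambda>z. \<Inter>i\<in>{..<k}. Z i -` {z i} \<inter> space M"
  let ?S = "{z \<in> {..<k} \<rightarrow>\<^sub>E carrier G. P z}"
  have one: "prob (Z i -` {y} \<inter> space M) = 1 / real (order G)" if "i < k" "y \<in> carrier G" for i y
  proof -
    have "prob (Z i -` {y} \<inter> space M) = measure (distr M (count_space (carrier G)) (Z i)) {y}"
      using that by (intro measure_distr[symmetric] meas) auto
    also have "distr M (count_space (carrier G)) (Z i) = uniform_count_measure (carrier G)"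
      using iid that by (simp add: iid_uniform_def)
    also have "measure (uniform_count_measure (carrier G)) {y} = 1 / real (order G)"
      using that fin by (subst measure_uniform_count_measure) (auto simp: order_def)
    finally show ?thesis .
  qed
  have F: "prob (?F z) = 1 / real (order G) ^ k" if "z \<in> {..<k} \<rightarrow>\<^sub>E carrier G" for z
  proof -
    have "prob (?F z) = (\<Prod>i\<in>{..<k}. prob (Z i -` {z i} \<inter> space M))"
      using k that by (intro indep_varsD[OF indep]) (auto simp: PiE_iff)
    also have "\<dots> = (\<Prod>i\<in>{..<k}. 1 / real (order G))"
      using that by (intro prod.cong refl one) (auto simp: PiE_iff)
    finally show ?thesis by (simp add: power_divide)
  qed
  have Fsets: "?F z \<in> events" if "z \<in> {..<k} \<rightarrow>\<^sub>E carrier G" for z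
  proof (rule sets.finite_INT)
    fix i assume "i \<in> {..<k}"
    then show "Z i -` {z i} \<inter> space M \<in> events"
      using that meas by (intro measurable_sets[of "Z i" M "count_space (carrier G)"]) (auto simp: PiE_iff)
  qed (use k in auto)
  have finS: "finite ?S"
    by (rule finite_subset[of _ "{..<k} \<rightarrow>\<^sub>E carrier G"]) (use fin in \<open>auto intro: finite_PiE\<close>)
  have "?E = (\<Union>z\<in>?S. ?F z)"
  proof
    show "?E \<subseteq> (\<Union>z\<in>?S. ?F z)"
    proof
      fix \<omega> assume "\<omega> \<in> ?E"
      then show "\<omega> \<in> (\<Union>z\<in>?S. ?F z)"
        using car k by (intro UN_I[of "\<lambda>i\<in>{..<k}. Z i \<omega>"]) auto
    qed
    show "(\<Union>z\<in>?S. ?F z) \<subseteq> ?E"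
    proof clarify
      fix \<omega> z assume z: "z \<in> {..<k} \<rightarrow>\<^sub>E carrier G" "P z" and \<omega>: "\<omega> \<in> ?F z"
      have "(\<lambda>i\<in>{..<k}. Z i \<omega>) = z"
      proof
        fix i show "(\<lambda>i\<in>{..<k}. Z i \<omega>) i = z i"
        proof (cases "i < k")
          case True
          then have "\<omega> \<in> Z i -` {z i}" using \<omega> by blast
          then show ?thesis using True by simp
        next
          case False
          then show ?thesis using PiE_arb[OF z(1), of i] by simp
        qed
      qed
      moreover have "\<omega> \<in> space M" using \<omega> k by blast
      ultimately show "\<omega> \<in> space M \<and> P (\<lambda>i\<in>{..<k}. Z i \<omega>)"
        using z(2) by simp
    qed
  qed
  moreover have "(\<Union>z\<in>?S. ?F z) \<in> events"
    by (rule sets.finite_UN[OF finS], rule Fsets, simp)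
  moreover have "prob (\<Union>z\<in>?S. ?F z) = (\<Sum>z\<in>?S. prob (?F z))"
  proof (rule finite_measure_finite_Union[OF finS])
    show "?F ` ?S \<subseteq> events"
      by (rule image_subsetI, rule Fsets, simp)
    show "disjoint_family_on ?F ?S"
    proof (unfold disjoint_family_on_def, intro ballI impI)
      fix y z assume yz: "y \<in> ?S" "z \<in> ?S" "y \<noteq> z"
      then obtain i where i: "y i \<noteq> z i" by (auto simp: fun_eq_iff)
      then have "i < k"
        using yz PiE_arb[of y "{..<k}" "\<lambda>_. carrier G" i] PiE_arb[of z "{..<k}" "\<lambda>_. carrier G" i]
        by (cases "i < k") auto
      then have "?F y \<subseteq> Z i -` {y i}" "?F z \<subseteq> Z i -` {z i}" by blast+
      moreover have "Z i -` {y i} \<inter> Z i -` {z i} = {}" using i by auto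
      ultimately show "?F y \<inter> ?F z = {}" by blast
    qed
  qed
  moreover have "(\<Sum>z\<in>?S. prob (?F z)) = (\<Sum>z\<in>?S. 1 / real (order G) ^ k)"
    by (rule sum.cong) (use F in auto)
  ultimately show "?E \<in> events" "prob ?E = real (card ?S) / real (order G) ^ k"
    by simp_all
qed

lemma typical_dist_le:
  assumes "0 \<le> R" "\<beta> * real (order G) \<le> real (card (Lq_ball s q G k z R))"
  shows "typical_dist s q G k z \<beta> \<le> ereal R"
  unfolding typical_dist_def using assms by (intro Inf_lower) auto

lemma typical_dist_ge:
  assumes "\<And>R. 0 \<le> R \<Longrightarrow> R < R0 \<Longrightarrow> real (card (Lq_ball s q G k z R)) < \<beta> * real (order G)"
  shows "ereal R0 \<le> typical_dist s q G k z \<beta>"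
  unfolding typical_dist_def using assms by (intro Inf_greatest) (force simp: not_le[symmetric])

lemma order_root_power:
  assumes "0 < n" "0 < k"
  shows "(real n powr (1 / real k)) ^ k = real n"
  using assms by (simp add: powr_power)

text \<open>With C r = (1 - epsilon) |G|^(1/k), the base of the count is at most (1 - epsilon/2)
  |G|^(1/k): half of epsilon is reserved for the additive exp(1/q). Its k-th power is (1 -
  epsilon/2)^k |G|.\<close>

lemma (in comm_group) typical_dist_lower_bound:
  assumes q: "1 \<le> q" and k: "0 < k" and fin: "finite (carrier G)"
    and z: "\<And>i. i < k \<Longrightarrow> z i \<in> carrier G" and \<epsilon>: "0 < \<epsilon>" "\<epsilon> < 1"
    and w: "exp (root_exp q) \<le> \<epsilon> / 2 * real (order G) powr (1 / real k)"
    and small: "(1 - \<epsilon> / 2) ^ k < \<beta>"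
  shows "ereal ((1 - \<epsilon>) * D_const s q G k) \<le> typical_dist s q G k z \<beta>"
proof (rule typical_dist_ge)
  let ?w = "real (order G) powr (1 / real k)" and ?C = "C_const Directed q"
  let ?f = "\<lambda>xs. lin_comb G k z (\<lambda>i. coefficient s (xs ! i))"
  fix R assume "0 \<le> R" and R: "R < (1 - \<epsilon>) * D_const s q G k"
  have n0: "0 < order G" using fin by (auto simp: order_def card_gt_0_iff)
  have w0: "0 < ?w" using n0 by simp
  have C0: "0 < ?C" using q by (rule C_const_pos)
  define r where "r = (1 - \<epsilon>) * ?w / ?C"
  have r0: "0 < r" using w0 C0 \<epsilon> by (simp add: r_def)
  have "(1 - \<epsilon>) * D_const s q G k = real k powr root_exp q * r / real (sign_count s)"
    unfolding D_const_def C_const_eq[of s] r_def by (simp add: mult_ac del: C_const.simps)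
  then have "Lq_ball s q G k z R \<subseteq> ?f ` qball q k r"
    using Lq_ball_subset_image_qball[OF q k z r0] R by simp
  then have "card (Lq_ball s q G k z R) \<le> card (qball q k r)"
    by (meson card_image_le card_mono finite_imageI finite_qball[OF q] order_trans)
  then have "real (card (Lq_ball s q G k z R)) \<le> (exp (root_exp q) + ?C * r) ^ k"
    using card_qball_le[OF q r0, of k] by linarith
  also have "\<dots> \<le> ((1 - \<epsilon> / 2) * ?w) ^ k"
  proof (rule power_mono)
    show "exp (root_exp q) + ?C * r \<le> (1 - \<epsilon> / 2) * ?w"
    proof -
      have "?C * r = (1 - \<epsilon>) * ?w" using C0 by (simp add: r_def del: C_const.simps)
      then show ?thesis using w by (simp add: algebra_simps)
    qed
    show "0 \<le> exp (root_exp q) + ?C * r"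
      using C0 r0 by (intro add_nonneg_nonneg mult_nonneg_nonneg less_imp_le) auto
  qed
  also have "\<dots> = (1 - \<epsilon> / 2) ^ k * real (order G)"
    using order_root_power[OF n0 k] by (simp add: power_mult_distrib)
  also have "\<dots> < \<beta> * real (order G)"
    using small n0 by simp
  finally show "real (card (Lq_ball s q G k z R)) < \<beta> * real (order G)" .
qed

section \<open>Upper bound for the typical distance with random generators\<close>

text \<open>The factor 1 + K g / w is the loss of a residue class modulo g against g^-1 per
  coordinate, and 2^(delta/4) the loss in the lattice count. For g small against w the product is at
  most 2^(delta/2); otherwise it is bounded by a constant while g is large.\<close>

lemma divisor_weight_bound:
  fixes \<delta> K L :: real
  assumes \<delta>: "0 < \<delta>" and K: "0 < K" and L: "0 < L"
  obtains w0 where "0 < w0"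
    "\<And>w g. w0 \<le> w \<Longrightarrow> 2 \<le> g \<Longrightarrow> g \<le> L * w \<Longrightarrow> 2 powr (\<delta> / 4) * (1 + K * g / w) \<le> g powr (\<delta> / 2)"
proof -
  define b where "b = (2::real) powr (\<delta> / 4)"
  have b: "1 < b" using \<delta> by (simp add: b_def)
  have bb: "b * b = 2 powr (\<delta> / 2)"
    by (simp add: b_def flip: powr_add)
  \<comment> \<open>Beyond y, the power g^(delta/2) exceeds the constant b (1 + K L); the choice of
    w0 makes the second case imply g > y.\<close>
  define y where "y = (b * (1 + K * L)) powr (2 / \<delta>)"
  have KL: "0 < b * (1 + K * L)" using b K L by (simp add: add_pos_pos)
  have y: "0 < y" "y powr (\<delta> / 2) = b * (1 + K * L)"
    using KL \<delta> by (auto simp: y_def powr_powr)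
  define w0 where "w0 = y * K / (b - 1)"
  have w0: "0 < w0" using y K b by (simp add: w0_def)
  have "b * (1 + K * g / w) \<le> g powr (\<delta> / 2)" if w: "w0 \<le> w" and g: "2 \<le> g" "g \<le> L * w" for w g
  proof (cases "K * g / w \<le> b - 1")
    case True
    then have "b * (1 + K * g / w) \<le> b * b"
      using b by (intro mult_left_mono) auto
    also have "\<dots> \<le> g powr (\<delta> / 2)"
      using bb g \<delta> by (auto intro: powr_mono2)
    finally show ?thesis .
  next
    case False
    have wpos: "0 < w" using w w0 by simp
    have "(b - 1) * w < K * g"
      using False wpos by (simp add: field_simps)
    moreover have "y * K \<le> (b - 1) * w"
      using w b by (simp add: w0_def field_simps)
    ultimately have "y < g" using K by (simp add: mult.commute less_le_trans)
         (metis K le_less_trans mult.commute mult_less_cancel_left_pos)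
    then have "b * (1 + K * L) \<le> g powr (\<delta> / 2)"
      unfolding y(2)[symmetric] using y \<delta> by (intro powr_mono2) auto
    moreover have "K * g / w \<le> K * L"
      using g wpos K by (simp add: field_simps)
    ultimately show ?thesis
      using b by (smt (verit) mult_left_mono)
  qed
  then show thesis using that[OF w0] by (simp add: b_def)
qed

lemma sum_inverse_squares_le: "(\<Sum>g\<in>{2..B}. 1 / (real g)\<^sup>2) \<le> 1"
proof -
  have "(\<Sum>g\<in>{2..B}. 1 / (real g)\<^sup>2) \<le> 1 - 1 / real B" if "1 \<le> B" for B
    using that
  proof (induction B rule: nat_induct_at_least)
    case (Suc B)
    have "(\<Sum>g\<in>{2..Suc B}. 1 / (real g)\<^sup>2) = (\<Sum>g\<in>{2..B}. 1 / (real g)\<^sup>2) + 1 / (real (Suc B))\<^sup>2"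
      using Suc.hyps by simp
    also have "\<dots> \<le> 1 - 1 / real B + 1 / (real (Suc B) * real B)"
      using Suc by (intro add_mono divide_left_mono) (auto simp: power2_eq_square)
    also have "\<dots> = 1 - 1 / real (Suc B)"
    proof -
      have "real B \<noteq> 0" "real (Suc B) \<noteq> 0" using Suc.hyps by auto
      then show ?thesis by (simp add: divide_simps) (simp add: algebra_simps)
    qed
    finally show ?case .
  qed simp
  from this[of B] show ?thesis
    by (cases "1 \<le> B") (auto intro: order_trans[of _ "1 - 1 / real B"])
qed

text \<open>The term g = 2 dominates: splitting off g^-2 leaves g^-(delta - 2) <= 2^-(delta -
  2).\<close>

lemma sum_powr_le:
  fixes \<delta> :: real
  assumes "2 \<le> \<delta>"
  shows "(\<Sum>g\<in>{2..B}. real g powr (- \<delta>)) \<le> 4 * 2 powr (- \<delta>)"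
proof -
  have "(\<Sum>g\<in>{2..B}. real g powr (- \<delta>)) \<le> (\<Sum>g\<in>{2..B}. 4 * 2 powr (- \<delta>) * (1 / (real g)\<^sup>2))"
  proof (rule sum_mono)
    fix g assume "g \<in> {2..B}"
    then have g: "2 \<le> real g" by simp
    have "real g powr (- \<delta>) = real g powr (- (\<delta> - 2)) * real g powr (- 2)"
      by (simp flip: powr_add)
    also have "\<dots> \<le> 2 powr (- (\<delta> - 2)) * real g powr (- 2)"
      using g assms by (intro mult_right_mono powr_mono2') auto
    also have "2 powr (- (\<delta> - 2)) = 4 * 2 powr (- \<delta>)"
      by (simp add: powr_diff powr_minus field_simps)
    also have "real g powr (- 2) = 1 / (real g)\<^sup>2"
      using g by (simp add: powr_minus divide_inverse)
    finally show "real g powr (- \<delta>) \<le> 4 * 2 powr (- \<delta>) * (1 / (real g)\<^sup>2)" .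
  qed
  also have "\<dots> = 4 * 2 powr (- \<delta>) * (\<Sum>g\<in>{2..B}. 1 / (real g)\<^sup>2)"
    by (simp add: sum_distrib_left)
  also have "\<dots> \<le> 4 * 2 powr (- \<delta>) * 1"
    by (intro mult_left_mono sum_inverse_squares_le) auto
  finally show ?thesis by simp
qed

text \<open>\<open>K\<close> and \<open>w0\<close> are chosen before the group, the space and beta,
  so the bound applies along a sequence. \<open>S\<close> need not be measurable; it is enclosed in
  a measurable event about the tuple of generators.\<close>

lemma exists_typical_dist_upper_bound:
  fixes q :: ereal and \<epsilon> \<delta> :: real and s :: orientation
  assumes q: "1 \<le> q" and \<epsilon>: "0 < \<epsilon>" and \<delta>: "0 < \<delta>"
  obtains K w0 where
    "\<And>(G :: ('a, 'b) monoid_scheme) k (M :: 'w measure) Z \<beta> S. comm_group G \<Longrightarrow> finite (carrier G) \<Longrightarrow> 0 < k \<Longrightarrow> K \<le> k \<Longrightarrow>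
      w0 \<le> real (order G) powr (1 / real k) \<Longrightarrow> real (min_gens G) \<le> (1 - \<delta>) * real k \<Longrightarrow>
      iid_uniform M G k Z \<Longrightarrow> 0 < \<beta> \<Longrightarrow> \<beta> < 1 \<Longrightarrow>
      S \<subseteq> {\<omega> \<in> space M. \<not> typical_dist s q G k (\<lambda>i. Z i \<omega>) \<beta> \<le> ereal ((1 + \<epsilon>) * D_const s q G k)} \<Longrightarrow>
      measure M S \<le> ((1 / (1 + \<epsilon> / 4)) ^ k + 4 * (2 powr (- (\<delta> / 2))) ^ k) / (1 / \<beta> - 1)"
proof -
  let ?C = "C_const Directed q" and ?c = "real (sign_count s)" and ?E = "exp (root_exp q)"
  have C0: "0 < ?C" using q by (rule C_const_pos)
  \<comment> \<open>The surplus epsilon is spent in quarters. Vectors are taken at 1 + epsilon/2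
    times the critical radius; the count loses at most one quarter through eta, leaving growth 1 +
    epsilon/4. Lengths grow to 1 + 3 epsilon/4 through eta1, and the additive rounding takes the
    last quarter.\<close>
  define a where "a = 1 + \<epsilon> / 2"
  define \<eta>1 where "\<eta>1 = \<epsilon> / (4 + 2 * \<epsilon>)"
  \<comment> \<open>The first entry keeps (1 - eta) a above 1 + epsilon/4; the second bounds the
    loss 1 / (1 - eta) by the 2^(delta/4) of \<open>divisor_weight_bound\<close>.\<close>
  define \<eta> where "\<eta> = min (1 - (1 + \<epsilon> / 4) / a) (1 - 2 powr (- (\<delta> / 4)))"
  have a: "0 < a" "(1 + \<epsilon> / 4) / a < 1" "0 < (1 + \<epsilon> / 4) / a"
    using \<epsilon> by (auto simp: a_def)
  have \<eta>1: "0 < \<eta>1" "(1 + \<eta>1) * a = 1 + 3 * \<epsilon> / 4"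
    using \<epsilon> by (auto simp: \<eta>1_def a_def field_simps)
  have d1: "2 powr (- (\<delta> / 4)) < 1"
    using \<delta> by (simp add: powr_less_one)
  have \<eta>: "0 < \<eta>" "\<eta> < 1"
    using a d1 by (auto simp: \<eta>_def min_def)
  have "(1 + \<epsilon> / 4) / a \<le> 1 - \<eta>"
    by (simp add: \<eta>_def)
  then have \<eta>a: "1 + \<epsilon> / 4 \<le> (1 - \<eta>) * a"
    using a by (simp add: divide_le_eq)
  have "2 powr (- (\<delta> / 4)) \<le> 1 - \<eta>"
    by (simp add: \<eta>_def)
  then have \<eta>d: "1 / (1 - \<eta>) \<le> 2 powr (\<delta> / 4)"
    using \<eta> by (simp add: powr_minus field_simps)
  show thesis
  proof (rule exists_card_bounded_qball_ge[OF q \<eta>])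
    fix k0 and L :: real
    assume L: "0 < L" and ge: "\<And>k \<rho>. k0 \<le> k \<Longrightarrow> 0 < \<rho> \<Longrightarrow>
      ((1 - \<eta>) * (?C * \<rho>)) ^ k \<le> real (card {xs \<in> qball q k \<rho>. \<forall>x\<in>set xs. real x \<le> L * \<rho>})"
    have K0: "0 < ?c * ?E / a" "0 < 2 * L * a / ?C"
      using a L C0 by auto
    obtain w1 where w1: "0 < w1" and weight: "\<And>w g. w1 \<le> w \<Longrightarrow> 2 \<le> g \<Longrightarrow> g \<le> 2 * L * a / ?C * w \<Longrightarrow>
      2 powr (\<delta> / 4) * (1 + ?c * ?E / a * g / w) \<le> g powr (\<delta> / 2)"
      using divisor_weight_bound[OF \<delta> K0] by blast
    define w2 where "w2 = (1 + 1 / \<eta>1) * ?C / (\<epsilon> / 4)"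
    \<comment> \<open>The bound 4 / delta on k makes delta k / 2 at least 2, as in
      \<open>sum_powr_le\<close>; \<open>w1\<close> serves the collision terms and \<open>w2\<close>
      the additive rounding.\<close>
    show thesis
    proof (rule that[of "max k0 (nat \<lceil>4 / \<delta>\<rceil>)" "max w1 w2"])
      fix G :: "('a, 'b) monoid_scheme" and k and M :: "'w measure" and Z and \<beta> :: real and S
      assume grp: "comm_group G" and fin: "finite (carrier G)" and k: "0 < k" "max k0 (nat \<lceil>4 / \<delta>\<rceil>) \<le> k"
        and w: "max w1 w2 \<le> real (order G) powr (1 / real k)"
        and d: "real (min_gens G) \<le> (1 - \<delta>) * real k"
        and iid: "iid_uniform M G k Z" and \<beta>: "0 < \<beta>" "\<beta> < 1"
        and S: "S \<subseteq> {\<omega> \<in> space M. \<not> typical_dist s q G k (\<lambda>i. Z i \<omega>) \<beta> \<le> ereal ((1 + \<epsilon>) * D_const s q G k)}"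
      interpret comm_group G by (rule grp)
      interpret prob_space M using iid by (simp add: iid_uniform_def)
      let ?w = "real (order G) powr (1 / real k)"
      have n0: "0 < order G" using fin by (auto simp: order_def card_gt_0_iff)
      have w0: "0 < ?w" using n0 by simp
      have wk: "?w ^ k = real (order G)" by (rule order_root_power[OF n0 k(1)])
      have k\<delta>: "2 \<le> \<delta> / 2 * real k"
      proof -
        have "4 / \<delta> \<le> real k" using k(2) by linarith
        then show ?thesis using \<delta> by (simp add: field_simps)
      qed
      define \<rho> where "\<rho> = a * ?w / ?C"
      have \<rho>: "0 < \<rho>" "?C * \<rho> = a * ?w"
        using a w0 C0 by (auto simp: \<rho>_def simp del: C_const.simps)
      define A where "A = {xs \<in> qball q k \<rho>. \<forall>x\<in>set xs. real x \<le> L * \<rho>}"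
      define B where "B = nat \<lfloor>2 * L * \<rho>\<rfloor>"
      define v where "v = (\<lambda>xs i. coefficient s (xs ! i))"
      define F where "F = (\<lambda>g :: nat. (?c * ?E + a * ?w / real g) ^ k)"
      have len: "length xs = k" if "xs \<in> A" for xs
        using that by (auto simp: A_def qball_def powr_sum_lists_def split: if_splits)
      have finA: "finite A"
        using finite_qball[OF q] by (simp add: A_def)
      have cA: "((1 - \<eta>) * (a * ?w)) ^ k \<le> real (card A)"
        unfolding A_def \<rho>(2)[symmetric] using k \<rho> by (intro ge) auto
      have A0: "0 < ((1 - \<eta>) * (a * ?w)) ^ k"
        using \<eta> a w0 by simp
      then have cA0: "0 < real (card A)" using cA by linarith
      then have Ane: "A \<noteq> {}" by auto
      have inj: "x = y" if "x \<in> A" "y \<in> A" "\<forall>i<k. v x i = v y i" for x y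
        using that len by (intro nth_equalityI) (auto simp: v_def)
      have bd: "\<bar>v x i - v y i\<bar> \<le> int B" if "x \<in> A" "y \<in> A" "i < k" for x y i
      proof -
        have "real (x ! i) \<le> L * \<rho>" "real (y ! i) \<le> L * \<rho>"
          using that len by (auto simp: A_def)
        moreover have "\<bar>v x i - v y i\<bar> \<le> int (x ! i) + int (y ! i)"
          using abs_coefficient_bounds(3)[of s "x ! i"] abs_coefficient_bounds(3)[of s "y ! i"]
          by (simp add: v_def)
        ultimately show ?thesis
          unfolding B_def using L \<rho> by linarith
      qed
      have classes: "real (card {y \<in> A. \<forall>i<k. int g dvd v x i - v y i}) \<le> F g" if "g \<in> {2..B}" for x g
      proof -
        have "card {y \<in> A. \<forall>i<k. int g dvd v x i - v y i}
            \<le> card {y \<in> qball q k \<rho>. \<forall>i<k. int g dvd v x i - coefficient s (y ! i)}"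
          by (intro card_mono) (auto simp: A_def v_def finite_qball[OF q])
        then show ?thesis
          using card_qball_residue_class_le[OF q \<rho>(1), of g k "v x" s] that \<rho>(2)
          by (simp add: F_def del: C_const.simps)
      qed
      have first: "real (order G) / real (card A) \<le> (1 / (1 + \<epsilon> / 4)) ^ k"
      proof -
        have "((1 + \<epsilon> / 4) * ?w) ^ k \<le> ((1 - \<eta>) * (a * ?w)) ^ k"
          using \<eta>a w0 \<epsilon> by (intro power_mono) (auto simp: mult.assoc[symmetric])
        then have "(1 + \<epsilon> / 4) ^ k * real (order G) \<le> real (card A)"
          using cA wk by (simp add: power_mult_distrib)
        then show ?thesis
          using cA0 \<epsilon> by (simp add: power_divide field_simps)
      qed
      \<comment> \<open>Per coordinate, the rank contributes g^(1 - delta) and the residue class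
        about 1/g, up to the losses in \<open>divisor_weight_bound\<close>. These cost g^(delta/2),
        so g^(-delta/2) is left.\<close>
      have summand: "real g ^ min_gens G * F g / real (card A) \<le> real g powr (- (\<delta> / 2 * real k))"
        if g: "g \<in> {2..B}" for g
      proof -
        have g2: "2 \<le> real g" using g by simp
        have "real g \<le> 2 * L * \<rho>"
          using g L \<rho> unfolding B_def by (simp add: le_nat_floor le_floor_iff nat_le_iff) linarith
        then have gL: "real g \<le> 2 * L * a / ?C * ?w"
          by (simp add: \<rho>_def del: C_const.simps)
        have "real g ^ min_gens G = real g powr real (min_gens G)"
          using g2 by (simp add: powr_realpow)
        also have "\<dots> \<le> real g powr ((1 - \<delta>) * real k)"
          using g2 d by (intro powr_mono) auto
        also have "\<dots> = (real g powr (1 - \<delta>)) ^ k"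
          using g2 by (simp add: powr_power mult.commute)
        finally have "real g ^ min_gens G * F g / real (card A)
            \<le> (real g powr (1 - \<delta>)) ^ k * F g / real (card A)"
          using a w0 cA0 unfolding F_def by (intro divide_right_mono mult_right_mono) auto
        also have "\<dots> \<le> (real g powr (1 - \<delta>)) ^ k * F g / ((1 - \<eta>) * (a * ?w)) ^ k"
          using cA A0 cA0 a w0 unfolding F_def
          by (intro divide_left_mono mult_nonneg_nonneg mult_pos_pos) auto
        also have "\<dots> = (real g powr (1 - \<delta>) * (?c * ?E + a * ?w / real g) / ((1 - \<eta>) * (a * ?w))) ^ k"
          by (simp add: F_def power_mult_distrib power_divide)
        also have "real g powr (1 - \<delta>) * (?c * ?E + a * ?w / real g) / ((1 - \<eta>) * (a * ?w))
            = real g powr (- \<delta>) * (1 / (1 - \<eta>) * (1 + ?c * ?E / a * real g / ?w))"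
        proof -
          have "real g powr (1 - \<delta>) = real g * real g powr (- \<delta>)"
            using g2 by (simp add: powr_diff powr_minus divide_inverse)
          then show ?thesis
            using g2 a w0 \<eta> by (simp add: field_simps)
        qed
        also have "(\<dots>) ^ k \<le> (real g powr (- (\<delta> / 2))) ^ k"
        proof (rule power_mono)
          have "1 / (1 - \<eta>) * (1 + ?c * ?E / a * real g / ?w) \<le> 2 powr (\<delta> / 4) * (1 + ?c * ?E / a * real g / ?w)"
            using a w0 by (intro mult_right_mono \<eta>d) auto
          also have "\<dots> \<le> real g powr (\<delta> / 2)"
            using w g2 gL by (intro weight) auto
          finally have "real g powr (- \<delta>) * (1 / (1 - \<eta>) * (1 + ?c * ?E / a * real g / ?w))
              \<le> real g powr (- \<delta>) * real g powr (\<delta> / 2)"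
            by (intro mult_left_mono) auto
          also have "\<dots> = real g powr (- (\<delta> / 2))"
            by (simp flip: powr_add)
          finally show "real g powr (- \<delta>) * (1 / (1 - \<eta>) * (1 + ?c * ?E / a * real g / ?w))
              \<le> real g powr (- (\<delta> / 2))" .
          show "0 \<le> real g powr (- \<delta>) * (1 / (1 - \<eta>) * (1 + ?c * ?E / a * real g / ?w))"
            using a w0 \<eta> by (intro mult_nonneg_nonneg) auto
        qed
        also have "\<dots> = real g powr (- (\<delta> / 2 * real k))"
          using g2 by (simp add: powr_power mult.commute)
        finally show ?thesis .
      qed
      have second: "(\<Sum>g\<in>{2..B}. real g ^ min_gens G * F g) / real (card A) \<le> 4 * (2 powr (- (\<delta> / 2))) ^ k"
      proof -
        have "(\<Sum>g\<in>{2..B}. real g ^ min_gens G * F g) / real (card A)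
            \<le> (\<Sum>g\<in>{2..B}. real g powr (- (\<delta> / 2 * real k)))"
          unfolding sum_divide_distrib by (intro sum_mono summand)
        also have "\<dots> \<le> 4 * 2 powr (- (\<delta> / 2 * real k))"
          by (rule sum_powr_le[OF k\<delta>])
        also have "2 powr (- (\<delta> / 2 * real k)) = (2 powr (- (\<delta> / 2))) ^ k"
          by (simp add: powr_power mult.commute)
        finally show ?thesis .
      qed
      define P where "P = (\<lambda>z. real (card ((\<lambda>xs. lin_comb G k z (v xs)) ` A)) < \<beta> * real (order G))"
      have "S \<subseteq> {\<omega> \<in> space M. P (\<lambda>i\<in>{..<k}. Z i \<omega>)}"
      proof
        fix \<omega> assume "\<omega> \<in> S"
        then have \<omega>: "\<omega> \<in> space M"
          and far: "\<not> typical_dist s q G k (\<lambda>i. Z i \<omega>) \<beta> \<le> ereal ((1 + \<epsilon>) * D_const s q G k)"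
          using S by auto
        have z: "Z i \<omega> \<in> carrier G" if "i < k" for i
          by (rule iid_uniform_measure(3)[OF iid fin k(1) \<omega> that])
        let ?R = "(1 + \<epsilon>) * D_const s q G k"
        have D: "?R = real k powr root_exp q * ((1 + \<epsilon>) * ?w / ?C) / ?c"
          unfolding D_const_def C_const_eq[of s] by (simp add: mult_ac del: C_const.simps)
        have R0: "0 \<le> ?R"
          unfolding D using C0 \<epsilon> w0 by (intro divide_nonneg_nonneg mult_nonneg_nonneg) auto
        have "1 + 1 / \<eta>1 \<le> \<epsilon> / 4 * ?w / ?C"
          using w C0 \<epsilon> by (simp add: w2_def field_simps del: C_const.simps)
        moreover have "(1 + \<eta>1) * \<rho> = (1 + 3 * \<epsilon> / 4) * ?w / ?C"
          unfolding \<rho>_def \<eta>1(2)[symmetric] by (simp del: C_const.simps)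
        moreover have "(1 + 3 * \<epsilon> / 4) * ?w / ?C + \<epsilon> / 4 * ?w / ?C = (1 + \<epsilon>) * ?w / ?C"
          unfolding add_divide_distrib[symmetric] distrib_right[symmetric] by simp
        ultimately have "(1 + \<eta>1) * \<rho> + (1 + 1 / \<eta>1) \<le> (1 + \<epsilon>) * ?w / ?C"
          by linarith
        then have rad: "real k powr root_exp q * ((1 + \<eta>1) * \<rho> + (1 + 1 / \<eta>1)) / ?c \<le> ?R"
          unfolding D by (intro divide_right_mono mult_left_mono) auto
        have sub: "(\<lambda>xs. lin_comb G k (\<lambda>i. Z i \<omega>) (v xs)) ` A \<subseteq> Lq_ball s q G k (\<lambda>i. Z i \<omega>) ?R"
          unfolding v_def A_def using lin_comb_mem_Lq_ball[OF q k(1) z \<rho>(1) \<eta>1(1) _ rad] by auto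
        have "\<not> \<beta> * real (order G) \<le> real (card (Lq_ball s q G k (\<lambda>i. Z i \<omega>) ?R))"
          using far typical_dist_le[OF R0] by blast
        moreover have "card ((\<lambda>xs. lin_comb G k (\<lambda>i. Z i \<omega>) (v xs)) ` A) \<le> card (Lq_ball s q G k (\<lambda>i. Z i \<omega>) ?R)"
          by (rule card_mono[OF _ sub]) (simp add: Lq_ball_def fin)
        moreover have "lin_comb G k (\<lambda>i\<in>{..<k}. Z i \<omega>) (v xs) = lin_comb G k (\<lambda>i. Z i \<omega>) (v xs)" for xs
          by (rule lin_comb_cong) (use z in auto)
        ultimately show "\<omega> \<in> {\<omega> \<in> space M. P (\<lambda>i\<in>{..<k}. Z i \<omega>)}"
          using \<omega> by (simp add: P_def)
      qed
      then have "measure M S \<le> measure M {\<omega> \<in> space M. P (\<lambda>i\<in>{..<k}. Z i \<omega>)}"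
        by (rule finite_measure_mono[OF _ iid_uniform_measure(1)[OF iid fin k(1)]])
      also have "\<dots> = real (card {z \<in> {..<k} \<rightarrow>\<^sub>E carrier G. P z}) / real (order G) ^ k"
        by (rule iid_uniform_measure(2)[OF iid fin k(1)])
      also have "\<dots> \<le> (real (order G) / real (card A)
         + (\<Sum>g\<in>{2..B}. real g ^ min_gens G * F g) / real (card A)) / (1 / \<beta> - 1)"
        unfolding P_def by (rule card_bad_generators_le[OF fin finA Ane inj bd classes \<beta>])
      also have "\<dots> \<le> ((1 / (1 + \<epsilon> / 4)) ^ k + 4 * (2 powr (- (\<delta> / 2))) ^ k) / (1 / \<beta> - 1)"
        using first second \<beta> by (intro divide_right_mono add_mono) auto
      finally show "measure M S \<le> ((1 / (1 + \<epsilon> / 4)) ^ k + 4 * (2 powr (- (\<delta> / 2))) ^ k) / (1 / \<beta> - 1)" .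
    qed
  qed
qed

section \<open>Asymptotics along the sequence\<close>

lemma order_root_at_top:
  fixes k n :: "nat \<Rightarrow> nat"
  assumes k_pos: "\<And>N. 0 < k N" and n_pos: "\<And>N. 0 < n N"
    and lim: "(\<lambda>N. ereal (real (k N)) / ereal (ln (real (n N)))) \<longlonglongrightarrow> 0"
  shows "filterlim (\<lambda>N. real (n N) powr (1 / real (k N))) at_top sequentially"
  unfolding filterlim_at_top
proof
  fix x :: real
  define y where "y = max 1 x"
  have y: "0 < y" "0 \<le> ln y" by (auto simp: y_def)
  have "\<forall>\<^sub>F N in sequentially. ereal (real (k N)) / ereal (ln (real (n N))) < ereal (1 / (ln y + 1))"
    using order_tendstoD(2)[OF lim, of "ereal (1 / (ln y + 1))"] y by (simp add: add_nonneg_pos)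
  then show "\<forall>\<^sub>F N in sequentially. x \<le> real (n N) powr (1 / real (k N))"
  proof eventually_elim
    case (elim N)
    have l0: "0 \<le> ln (real (n N))"
      using n_pos[of N] by simp
    \<comment> \<open>For n = 1 the quotient is k / 0 = \<infinity> in the extended reals, which its
      smallness excludes.\<close>
    have "ln (real (n N)) \<noteq> 0"
      using elim k_pos[of N] by auto
    then have l: "0 < ln (real (n N))" using l0 by simp
    then have "real (k N) / ln (real (n N)) < 1 / (ln y + 1)"
      using elim by simp
    then have "ln y + 1 < ln (real (n N)) / real (k N)"
      using l y k_pos[of N] by (simp add: field_simps add_nonneg_pos)
    then have "ln y \<le> 1 / real (k N) * ln (real (n N))" by simp
    then have "exp (ln y) \<le> exp (1 / real (k N) * ln (real (n N)))" by (simp only: exp_le_cancel_iff)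
    then have "y \<le> real (n N) powr (1 / real (k N))"
      using y n_pos[of N] by (simp add: powr_def)
    then show ?case by (simp add: y_def)
  qed
qed

text \<open>Conditions (b) and (d) and the law of \<open>Z\<close> are premises of the first
  conjunct only, because the second is claimed under (a) and (c) for every choice of
  generators.\<close>

theorem theorem7p1:
  fixes s :: orientation
    and q :: ereal
    and k :: "nat \<Rightarrow> nat"
    and G :: "nat \<Rightarrow> ('a, 'b) monoid_scheme"
    and M :: "nat \<Rightarrow> 'w measure"
    and Z :: "nat \<Rightarrow> nat \<Rightarrow> 'w \<Rightarrow> 'a"
  assumes q: "1 \<le> q"
    and k_pos: "\<And>N. 0 < k N"
    and grp: "\<And>N. comm_group (G N)"
    and fin: "\<And>N. finite (carrier (G N))"
    and a: "filterlim k at_top sequentially"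
           "(\<lambda>N. ereal (real (k N)) / ereal (ln (real (order (G N))))) \<longlonglongrightarrow> 0"
    and c: "\<And>N. 1 < q \<Longrightarrow> q < \<infinity> \<Longrightarrow>
              real (k N) \<le> ln (real (order (G N))) / ln (ln (real (order (G N))))"
  shows
    "((\<lambda>N. real (k N) powr root_exp q * real (order (G N)) powr (1 / real (k N))
           / real (m_star (G N))) \<longlonglongrightarrow> 0 \<longrightarrow>
      limsup (\<lambda>N. ereal (real (min_gens (G N)) / real (k N))) < rank_bound s \<longrightarrow>
      (\<forall>N. iid_uniform (M N) (G N) (k N) (Z N)) \<longrightarrow>
      (\<forall>\<beta>\<in>{0<..<1}.
         converges_in_prob M
           (\<lambda>N \<omega>. typical_dist s q (G N) (k N) (\<lambda>i. Z N i \<omega>) \<beta> / ereal (D_const s q (G N) (k N))) 1))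
     \<and>
     (\<forall>\<beta>\<in>{0<..<1}. \<forall>\<epsilon>>0. \<forall>\<^sub>F N in sequentially. \<forall>z. (\<forall>i<k N. z i \<in> carrier (G N)) \<longrightarrow>
        ereal ((1 - \<epsilon>) * D_const s q (G N) (k N)) \<le> typical_dist s q (G N) (k N) z \<beta>)"
proof -
  have n_pos: "0 < order (G N)" for N
    using fin[of N] group.is_monoid[OF comm_group.axioms(2)[OF grp[of N]]]
    by (auto simp: order_def card_gt_0_iff dest: monoid.one_closed)
  note w_top = order_root_at_top[OF k_pos n_pos a(2)]
  have D_pos: "0 < D_const s q (G N) (k N)" for N
    unfolding D_const_def using k_pos[of N] n_pos[of N] C_const_pos[OF q] by simp
  have k_top: "(\<lambda>N. x ^ k N) \<longlonglongrightarrow> 0" if "0 \<le> x" "x < 1" for x :: real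
    using LIMSEQ_power_zero[of x] that a(1) by (auto intro: filterlim_compose)
  have lower: "\<forall>\<^sub>F N in sequentially. \<forall>z. (\<forall>i<k N. z i \<in> carrier (G N)) \<longrightarrow>
        ereal ((1 - \<epsilon>) * D_const s q (G N) (k N)) \<le> typical_dist s q (G N) (k N) z \<beta>"
    if \<beta>: "0 < \<beta>" "\<beta> < 1" and \<epsilon>: "0 < \<epsilon>" for \<beta> \<epsilon> :: real
  proof (cases "\<epsilon> < 1")
    case True
    have "\<forall>\<^sub>F N in sequentially. exp (root_exp q) / (\<epsilon> / 2) \<le> real (order (G N)) powr (1 / real (k N))"
      using w_top by (simp add: filterlim_at_top)
    moreover have "\<forall>\<^sub>F N in sequentially. (1 - \<epsilon> / 2) ^ k N < \<beta>"
      using k_top[of "1 - \<epsilon> / 2"] \<beta> \<epsilon> True by (intro order_tendstoD) auto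
    ultimately show ?thesis
    proof eventually_elim
      case (elim N)
      then show ?case
        using comm_group.typical_dist_lower_bound[OF grp q k_pos fin _ \<epsilon> True _ elim(2)] \<epsilon>
        by (auto simp: field_simps)
    qed
  next
    case False
    \<comment> \<open>Here the claimed bound is at most 0, and admissible radii are
      nonnegative.\<close>
    have "ereal ((1 - \<epsilon>) * D_const s q (G N) (k N)) \<le> typical_dist s q (G N) (k N) z \<beta>" for N z
      using mult_nonpos_nonneg[of "1 - \<epsilon>" "D_const s q (G N) (k N)"] D_pos[of N] False
      by (intro typical_dist_ge) auto
    then show ?thesis by simp
  qed
  have upper: "converges_in_prob M
           (\<lambda>N \<omega>. typical_dist s q (G N) (k N) (\<lambda>i. Z N i \<omega>) \<beta> / ereal (D_const s q (G N) (k N))) 1"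
    if ranks: "limsup (\<lambda>N. ereal (real (min_gens (G N)) / real (k N))) < rank_bound s"
      and iid: "\<forall>N. iid_uniform (M N) (G N) (k N) (Z N)" and \<beta>: "0 < \<beta>" "\<beta> < 1" for \<beta>
    unfolding converges_in_prob_def
  proof (intro allI impI)
    fix \<epsilon> :: real assume \<epsilon>: "0 < \<epsilon>"
    have "(1 :: ereal) / 2 \<le> 1"
      unfolding one_ereal_def numeral_eq_ereal by simp
    then have "rank_bound s \<le> 1"
      by (cases s) auto
    then have "limsup (\<lambda>N. ereal (real (min_gens (G N)) / real (k N))) < 1"
      using ranks by (rule order_less_le_trans[rotated])
    then obtain c where c: "limsup (\<lambda>N. ereal (real (min_gens (G N)) / real (k N))) < ereal c" "ereal c < 1"
      using ereal_dense2 by blast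
    have ranks': "\<forall>\<^sub>F N in sequentially. real (min_gens (G N)) \<le> (1 - (1 - c)) * real (k N)"
      using Limsup_lessD[OF c(1)] k_pos by (auto elim!: eventually_mono simp: field_simps)
    have \<delta>: "0 < 1 - c" using c(2) by simp
    let ?Y = "\<lambda>N \<omega>. typical_dist s q (G N) (k N) (\<lambda>i. Z N i \<omega>) \<beta> / ereal (D_const s q (G N) (k N))"
    let ?S = "\<lambda>N. {\<omega> \<in> space (M N). ereal \<epsilon> < \<bar>?Y N \<omega> - ereal 1\<bar>}"
    let ?b = "\<lambda>k. ((1 / (1 + \<epsilon> / 4)) ^ k + 4 * (2 powr (- ((1 - c) / 2))) ^ k) / (1 / \<beta> - 1)"
    show "(\<lambda>N. measure (M N) (?S N)) \<longlonglongrightarrow> 0"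
    proof (rule exists_typical_dist_upper_bound[OF q \<epsilon> \<delta>, where ?'a = 'a and ?'b = 'b and ?'w = 'w])
      fix K w0
      assume ub: "\<And>(G :: ('a, 'b) monoid_scheme) k (M :: 'w measure) Z \<beta> S. comm_group G \<Longrightarrow> finite (carrier G) \<Longrightarrow> 0 < k \<Longrightarrow> K \<le> k \<Longrightarrow>
        w0 \<le> real (order G) powr (1 / real k) \<Longrightarrow> real (min_gens G) \<le> (1 - (1 - c)) * real k \<Longrightarrow>
        iid_uniform M G k Z \<Longrightarrow> 0 < \<beta> \<Longrightarrow> \<beta> < 1 \<Longrightarrow>
        S \<subseteq> {\<omega> \<in> space M. \<not> typical_dist s q G k (\<lambda>i. Z i \<omega>) \<beta> \<le> ereal ((1 + \<epsilon>) * D_const s q G k)} \<Longrightarrow>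
        measure M S \<le> ((1 / (1 + \<epsilon> / 4)) ^ k + 4 * (2 powr (- ((1 - c) / 2))) ^ k) / (1 / \<beta> - 1)"
      have "\<forall>\<^sub>F N in sequentially. K \<le> k N"
        using a(1) by (simp add: filterlim_at_top)
      moreover have "\<forall>\<^sub>F N in sequentially. w0 \<le> real (order (G N)) powr (1 / real (k N))"
        using w_top by (simp add: filterlim_at_top)
      ultimately have le: "\<forall>\<^sub>F N in sequentially. measure (M N) (?S N) \<le> ?b (k N)"
        using ranks' lower[OF \<beta> \<epsilon>]
      proof eventually_elim
        case (elim N)
        let ?D = "D_const s q (G N) (k N)"
        \<comment> \<open>The lower bound holds for every outcome, so a deviation can only be
          upwards. Otherwise the typical distance is finite and the comparison takes place in the
          reals.\<close>
        have "?S N \<subseteq> {\<omega> \<in> space (M N). \<not> typical_dist s q (G N) (k N) (\<lambda>i. Z N i \<omega>) \<beta> \<le> ereal ((1 + \<epsilon>) * ?D)}"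
        proof clarify
          fix \<omega> assume \<omega>: "\<omega> \<in> space (M N)" and far: "ereal \<epsilon> < \<bar>?Y N \<omega> - ereal 1\<bar>"
            and near: "typical_dist s q (G N) (k N) (\<lambda>i. Z N i \<omega>) \<beta> \<le> ereal ((1 + \<epsilon>) * ?D)"
          have ge: "ereal ((1 - \<epsilon>) * ?D) \<le> typical_dist s q (G N) (k N) (\<lambda>i. Z N i \<omega>) \<beta>"
          proof (rule elim(4)[rule_format])
            fix i assume "i < k N"
            then show "Z N i \<omega> \<in> carrier (G N)"
              by (rule iid_uniform_measure(3)[OF iid[rule_format] fin k_pos \<omega>])
          qed
          obtain x where x: "typical_dist s q (G N) (k N) (\<lambda>i. Z N i \<omega>) \<beta> = ereal x"
            using near ge by (cases "typical_dist s q (G N) (k N) (\<lambda>i. Z N i \<omega>) \<beta>") auto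
          have "1 - \<epsilon> \<le> x / ?D" "x / ?D \<le> 1 + \<epsilon>"
            using near ge x D_pos[of N] by (auto simp: field_simps)
          moreover have "\<epsilon> < \<bar>x / ?D - 1\<bar>"
            using far D_pos[of N] by (simp add: x one_ereal_def)
          ultimately show False by linarith
        qed
        then show ?case
          by (rule ub[OF grp fin k_pos elim(1,2,3) iid[rule_format] \<beta>])
      qed
      have "(\<lambda>N. ?b (k N)) \<longlonglongrightarrow> (0 + 4 * 0) / (1 / \<beta> - 1)"
        using \<beta> \<epsilon> \<delta> by (intro tendsto_intros k_top) (auto intro: powr_less_one)
      then have lim: "(\<lambda>N. ?b (k N)) \<longlonglongrightarrow> 0" by simp
      show ?thesis
        by (rule tendsto_sandwich[OF _ le tendsto_const lim]) simp
    qed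
  qed
  show ?thesis
    using lower upper by auto
qed

end
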